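(* Let $(C,\Delta,\varepsilon,\alpha)$ be a Hom-coalgebra over a field $k$ and let $\lambda,\nu\in k$. Then the linear map $$B: C\otimes C\to C\otimes C,\qquad a\otimes b\mapsto \lambda\,\varepsilon(a)\,b_1\otimes b_2+\nu\,\varepsilon(b)\,a_1\otimes a_2-\lambda\,\alpha(a)\otimes\alpha(b)$$ is a solution of the Hom-Yang-Baxter equation (with respect to the twist map $\alpha$ on $C$).
   Context: Throughout, $k$ is a fixed field; vector spaces, linear maps and tensor products are over $k$. Sweedler notation $\Delta(c)=c_1\otimes c_2$ (summation understood) is used, with $c_{11}\otimes c_{12}=\Delta(c_1)$, $c_{21}\otimes c_{22}=\Delta(c_2)$. A Hom-coalgebra is a quadruple $(C,\Delta,\varepsilon,\alpha)$ where $C$ is a $k$-linear space, $\Delta:C\to C\otimes C$ and $\varepsilon:C\to k$ are $k$-linear maps, and $\alpha:C\to C$ is a linear endomorphism, such that for all $c\in C$: $\alpha(c)_1\otimes\alpha(c)_2=\alpha(c_1)\otimes\alpha(c_2)$, $\varepsilon\circ\alpha=\varepsilon$, $\alpha(c_1)\otimes c_{21}\otimes c_{22}=c_{11}\otimes c_{12}\otimes\alpha(c_2)$, and $\varepsilon(c_1)c_2=c_1\varepsilon(c_2)=\alpha(c)$. Hom-Yang-Baxter equation (HYBE): given a vector space $V$ and a linear endomorphism $\alpha$ of $V$, a linear map $B:V\otimes V\to V\otimes V$ is a solution of the HYBE if $B$ commutes with $\alpha\otimes\alpha$, i.e. $(\alpha\otimes\alpha)\circ B=B\circ(\alpha\otimes\alpha)$,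 and $$(\alpha\otimes B)\circ(B\otimes\alpha)\circ(\alpha\otimes B)=(B\otimes\alpha)\circ(\alpha\otimes B)\circ(B\otimes\alpha)$$ as maps $V\otimes V\otimes V\to V\otimes V\otimes V$. *)

theory Defs
  imports "HOL-Algebra.Module" "HOL-Algebra.AbelCoset"
begin

section \<open>Linear maps, free modules and quotients\<close>

definition linear_maps ::
  "('k, 'm) ring_scheme \<Rightarrow> ('k, 'a, 'p) module_scheme \<Rightarrow> ('k, 'b, 'q) module_scheme \<Rightarrow> ('a \<Rightarrow> 'b) set"
  where "linear_maps K M N =
    {f \<in> carrier M \<rightarrow> carrier N.
       (\<forall>x\<in>carrier M. \<forall>y\<in>carrier M. f (x \<oplus>\<^bsub>M\<^esub> y) = f x \<oplus>\<^bsub>N\<^esub> f y) \<and>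
       (\<forall>r\<in>carrier K. \<forall>x\<in>carrier M. f (r \<odot>\<^bsub>M\<^esub> x) = r \<odot>\<^bsub>N\<^esub> f x)}"

text \<open>The library's record for modules extends the record for rings, so the fields
  \<open>mult\<close> and \<open>one\<close> have to be filled; no notion below reads them.\<close>

definition scalars :: "('k, 'm) ring_scheme \<Rightarrow> ('k, 'k) module"
  where "scalars K = \<lparr>carrier = carrier K, mult = mult K, one = one K,
    zero = zero K, add = add K, smult = mult K\<rparr>"

definition free_module :: "('k, 'm) ring_scheme \<Rightarrow> 'x set \<Rightarrow> ('k, 'x \<Rightarrow> 'k) module"
  where "free_module K X =
    \<lparr>carrier = {f. f \<in> UNIV \<rightarrow> carrier K \<and> (\<forall>x. x \<notin> X \<longrightarrow> f x = \<zero>\<^bsub>K\<^esub>) \<and> finite {x. f x \<noteq> \<zero>\<^bsub>K\<^esub>}},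
     mult = undefined, one = undefined,
     zero = (\<lambda>x. \<zero>\<^bsub>K\<^esub>),
     add = (\<lambda>f g x. f x \<oplus>\<^bsub>K\<^esub> g x),
     smult = (\<lambda>r f x. r \<otimes>\<^bsub>K\<^esub> f x)\<rparr>"

definition free_gen :: "('k, 'm) ring_scheme \<Rightarrow> 'x \<Rightarrow> 'x \<Rightarrow> 'k"
  where "free_gen K x = (\<lambda>y. if y = x then \<one>\<^bsub>K\<^esub> else \<zero>\<^bsub>K\<^esub>)"

definition submodule_span ::
  "('k, 'm) ring_scheme \<Rightarrow> ('k, 'a, 'p) module_scheme \<Rightarrow> 'a set \<Rightarrow> 'a set"
  where "submodule_span K M S = \<Inter>{H. submodule H K M \<and> S \<subseteq> H}"

definition quotient_module :: "('k, 'a, 'p) module_scheme \<Rightarrow> 'a set \<Rightarrow> ('k, 'a set) module"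
  where "quotient_module M H =
    \<lparr>carrier = a_rcosets\<^bsub>M\<^esub> H, mult = undefined, one = undefined,
     zero = H, add = set_add M,
     smult = (\<lambda>r X. \<Union>x\<in>X. H +>\<^bsub>M\<^esub> (r \<odot>\<^bsub>M\<^esub> x))\<rparr>"


section \<open>The tensor product\<close>

definition tensor_relations ::
  "('k, 'm) ring_scheme \<Rightarrow> ('k, 'a, 'p) module_scheme \<Rightarrow> ('k, 'b, 'q) module_scheme \<Rightarrow> ('a \<times> 'b \<Rightarrow> 'k) set"
  where "tensor_relations K M N =
    (let F = free_module K (carrier M \<times> carrier N); e = (\<lambda>a b. free_gen K (a, b)) in
      {e (a \<oplus>\<^bsub>M\<^esub> a') b \<ominus>\<^bsub>F\<^esub> (e a b \<oplus>\<^bsub>F\<^esub> e a' b) | a a' b.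
         a \<in> carrier M \<and> a' \<in> carrier M \<and> b \<in> carrier N} \<union>
      {e a (b \<oplus>\<^bsub>N\<^esub> b') \<ominus>\<^bsub>F\<^esub> (e a b \<oplus>\<^bsub>F\<^esub> e a b') | a b b'.
         a \<in> carrier M \<and> b \<in> carrier N \<and> b' \<in> carrier N} \<union>
      {e (r \<odot>\<^bsub>M\<^esub> a) b \<ominus>\<^bsub>F\<^esub> r \<odot>\<^bsub>F\<^esub> e a b | r a b.
         r \<in> carrier K \<and> a \<in> carrier M \<and> b \<in> carrier N} \<union>
      {e a (r \<odot>\<^bsub>N\<^esub> b) \<ominus>\<^bsub>F\<^esub> r \<odot>\<^bsub>F\<^esub> e a b | r a b.
         r \<in> carrier K \<and> a \<in> carrier M \<and> b \<in> carrier N})"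

definition tensor_null ::
  "('k, 'm) ring_scheme \<Rightarrow> ('k, 'a, 'p) module_scheme \<Rightarrow> ('k, 'b, 'q) module_scheme \<Rightarrow> ('a \<times> 'b \<Rightarrow> 'k) set"
  where "tensor_null K M N =
    submodule_span K (free_module K (carrier M \<times> carrier N)) (tensor_relations K M N)"

type_synonym ('k, 'a, 'b) tensor = "('a \<times> 'b \<Rightarrow> 'k) set"

definition tensor_module ::
  "('k, 'm) ring_scheme \<Rightarrow> ('k, 'a, 'p) module_scheme \<Rightarrow> ('k, 'b, 'q) module_scheme \<Rightarrow>
   ('k, ('k, 'a, 'b) tensor) module"
  where "tensor_module K M N =
    quotient_module (free_module K (carrier M \<times> carrier N)) (tensor_null K M N)"

definition tensor ::
  "('k, 'm) ring_scheme \<Rightarrow> ('k, 'a, 'p) module_scheme \<Rightarrow> ('k, 'b, 'q) module_scheme \<Rightarrow>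
   'a \<Rightarrow> 'b \<Rightarrow> ('k, 'a, 'b) tensor"
  where "tensor K M N a b =
    tensor_null K M N +>\<^bsub>free_module K (carrier M \<times> carrier N)\<^esub> free_gen K (a, b)"

definition bilinear_maps ::
  "('k, 'm) ring_scheme \<Rightarrow> ('k, 'a, 'p) module_scheme \<Rightarrow> ('k, 'b, 'q) module_scheme \<Rightarrow>
   ('k, 'c, 'r) module_scheme \<Rightarrow> ('a \<Rightarrow> 'b \<Rightarrow> 'c) set"
  where "bilinear_maps K M N P =
    {\<beta>. (\<forall>a\<in>carrier M. \<beta> a \<in> linear_maps K N P) \<and>
        (\<forall>b\<in>carrier N. (\<lambda>a. \<beta> a b) \<in> linear_maps K M P)}"

text \<open>The linear map \<open>a \<otimes> b \<mapsto> \<beta> a b\<close>. It exists and is unique when \<open>\<beta>\<close> is bilinear: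
  \<open>tensor_universal\<close> below. Outside \<open>M \<otimes> N\<close> it takes the value \<open>undefined\<close>, as all
  members of \<open>extensional\<close> do.\<close>

definition tensor_lift ::
  "('k, 'm) ring_scheme \<Rightarrow> ('k, 'a, 'p) module_scheme \<Rightarrow> ('k, 'b, 'q) module_scheme \<Rightarrow>
   ('k, 'c, 'r) module_scheme \<Rightarrow> ('a \<Rightarrow> 'b \<Rightarrow> 'c) \<Rightarrow> ('k, 'a, 'b) tensor \<Rightarrow> 'c"
  where "tensor_lift K M N P \<beta> =
    (THE h. h \<in> linear_maps K (tensor_module K M N) P \<inter> extensional (carrier (tensor_module K M N)) \<and>
       (\<forall>a\<in>carrier M. \<forall>b\<in>carrier N. h (tensor K M N a b) = \<beta> a b))"

text \<open>The map \<open>f \<otimes> g\<close> from \<open>M \<otimes> N\<close> to \<open>M' \<otimes> N'\<close>.\<close>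

definition tensor_map ::
  "('k, 'm) ring_scheme \<Rightarrow> ('k, 'a, 'p) module_scheme \<Rightarrow> ('k, 'b, 'q) module_scheme \<Rightarrow>
   ('k, 'c, 'r) module_scheme \<Rightarrow> ('k, 'd, 's) module_scheme \<Rightarrow> ('a \<Rightarrow> 'c) \<Rightarrow> ('b \<Rightarrow> 'd) \<Rightarrow>
   ('k, 'a, 'b) tensor \<Rightarrow> ('k, 'c, 'd) tensor"
  where "tensor_map K M N M' N' f g =
    tensor_lift K M N (tensor_module K M' N') (\<lambda>a b. tensor K M' N' (f a) (g b))"

text \<open>The associativity isomorphism \<open>(a \<otimes> b) \<otimes> c \<mapsto> a \<otimes> (b \<otimes> c)\<close> and its inverse.\<close>

definition tensor_assoc ::
  "('k, 'm) ring_scheme \<Rightarrow> ('k, 'a, 'p) module_scheme \<Rightarrow> ('k, 'b, 'q) module_scheme \<Rightarrow>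
   ('k, 'c, 'r) module_scheme \<Rightarrow> ('k, ('k, 'a, 'b) tensor, 'c) tensor \<Rightarrow> ('k, 'a, ('k, 'b, 'c) tensor) tensor"
  where "tensor_assoc K M N P =
    (let T = tensor_module K M (tensor_module K N P) in
     tensor_lift K (tensor_module K M N) P T
       (\<lambda>t c. tensor_lift K M N T
          (\<lambda>a b. tensor K M (tensor_module K N P) a (tensor K N P b c)) t))"

definition tensor_assoc_inv ::
  "('k, 'm) ring_scheme \<Rightarrow> ('k, 'a, 'p) module_scheme \<Rightarrow> ('k, 'b, 'q) module_scheme \<Rightarrow>
   ('k, 'c, 'r) module_scheme \<Rightarrow> ('k, 'a, ('k, 'b, 'c) tensor) tensor \<Rightarrow> ('k, ('k, 'a, 'b) tensor, 'c) tensor"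
  where "tensor_assoc_inv K M N P =
    (let T = tensor_module K (tensor_module K M N) P in
     tensor_lift K M (tensor_module K N P) T
       (\<lambda>a t. tensor_lift K N P T
          (\<lambda>b c. tensor K (tensor_module K M N) P (tensor K M N a b) c) t))"


section \<open>Hom-coalgebras and the Hom-Yang-Baxter equation\<close>

text \<open>The threefold tensor power is \<open>C \<otimes> (C \<otimes> C)\<close> throughout. In Sweedler notation the two sides
  of \<open>coassoc\<close> are \<open>\<alpha>(c\<^sub>1) \<otimes> c\<^sub>2\<^sub>1 \<otimes> c\<^sub>2\<^sub>2\<close> and \<open>c\<^sub>1\<^sub>1 \<otimes> c\<^sub>1\<^sub>2 \<otimes> \<alpha>(c\<^sub>2)\<close>.\<close>

locale hom_coalgebra =
  fixes K :: "('k, 'm) ring_scheme"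
    and C :: "('k, 'c, 'p) module_scheme"
    and \<Delta> :: "'c \<Rightarrow> ('k, 'c, 'c) tensor"
    and \<epsilon> :: "'c \<Rightarrow> 'k"
    and \<alpha> :: "'c \<Rightarrow> 'c"
  assumes field_K: "field K"
    and vector_space_C: "module K C"
    and \<Delta>_linear: "\<Delta> \<in> linear_maps K C (tensor_module K C C)"
    and \<epsilon>_linear: "\<epsilon> \<in> linear_maps K C (scalars K)"
    and \<alpha>_linear: "\<alpha> \<in> linear_maps K C C"
    and \<Delta>_\<alpha>: "c \<in> carrier C \<Longrightarrow> \<Delta> (\<alpha> c) = tensor_map K C C C C \<alpha> \<alpha> (\<Delta> c)"
    and \<epsilon>_\<alpha>: "c \<in> carrier C \<Longrightarrow> \<epsilon> (\<alpha> c) = \<epsilon> c"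
    and coassoc: "c \<in> carrier C \<Longrightarrow>
      tensor_map K C C C (tensor_module K C C) \<alpha> \<Delta> (\<Delta> c) =
      tensor_assoc K C C C (tensor_map K C C (tensor_module K C C) C \<Delta> \<alpha> (\<Delta> c))"
    and counit_left: "c \<in> carrier C \<Longrightarrow>
      tensor_lift K C C C (\<lambda>a b. \<epsilon> a \<odot>\<^bsub>C\<^esub> b) (\<Delta> c) = \<alpha> c"
    and counit_right: "c \<in> carrier C \<Longrightarrow>
      tensor_lift K C C C (\<lambda>a b. \<epsilon> b \<odot>\<^bsub>C\<^esub> a) (\<Delta> c) = \<alpha> c"

text \<open>The maps \<open>f \<otimes> B\<close> and \<open>B \<otimes> f\<close> on \<open>V \<otimes> (V \<otimes> V)\<close>.\<close>

definition act_right ::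
  "('k, 'm) ring_scheme \<Rightarrow> ('k, 'v, 'p) module_scheme \<Rightarrow> ('v \<Rightarrow> 'v) \<Rightarrow>
   (('k, 'v, 'v) tensor \<Rightarrow> ('k, 'v, 'v) tensor) \<Rightarrow>
   ('k, 'v, ('k, 'v, 'v) tensor) tensor \<Rightarrow> ('k, 'v, ('k, 'v, 'v) tensor) tensor"
  where "act_right K V f B =
    tensor_map K V (tensor_module K V V) V (tensor_module K V V) f B"

definition act_left ::
  "('k, 'm) ring_scheme \<Rightarrow> ('k, 'v, 'p) module_scheme \<Rightarrow>
   (('k, 'v, 'v) tensor \<Rightarrow> ('k, 'v, 'v) tensor) \<Rightarrow> ('v \<Rightarrow> 'v) \<Rightarrow>
   ('k, 'v, ('k, 'v, 'v) tensor) tensor \<Rightarrow> ('k, 'v, ('k, 'v, 'v) tensor) tensor"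
  where "act_left K V B f =
    tensor_assoc K V V V \<circ>
    tensor_map K (tensor_module K V V) V (tensor_module K V V) V B f \<circ>
    tensor_assoc_inv K V V V"

definition hybe_solution ::
  "('k, 'm) ring_scheme \<Rightarrow> ('k, 'v, 'p) module_scheme \<Rightarrow> ('v \<Rightarrow> 'v) \<Rightarrow>
   (('k, 'v, 'v) tensor \<Rightarrow> ('k, 'v, 'v) tensor) \<Rightarrow> bool"
  where "hybe_solution K V \<alpha> B \<longleftrightarrow>
    B \<in> linear_maps K (tensor_module K V V) (tensor_module K V V) \<and>
    (\<forall>t\<in>carrier (tensor_module K V V).
       (tensor_map K V V V V \<alpha> \<alpha> \<circ> B) t = (B \<circ> tensor_map K V V V V \<alpha> \<alpha>) t) \<and>
    (\<forall>t\<in>carrier (tensor_module K V (tensor_module K V V)).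
       (act_right K V \<alpha> B \<circ> act_left K V B \<alpha> \<circ> act_right K V \<alpha> B) t =
       (act_left K V B \<alpha> \<circ> act_right K V \<alpha> B \<circ> act_left K V B \<alpha>) t)"

section \<open>Well-definedness\<close>

text \<open>The descriptions in \<open>tensor_lift\<close> above denote the intended maps: the tensor product has the
  universal property, \<open>f \<otimes> g\<close> and the associativity maps act on pure tensors as stated, and the
  bilinear argument whose linear extension is the Hom-Yang-Baxter map is indeed bilinear.\<close>


lemma linear_mapsD:
  assumes "f \<in> linear_maps K M N"
  shows "\<And>x. x \<in> carrier M \<Longrightarrow> f x \<in> carrier N"
    and "\<And>x y. x \<in> carrier M \<Longrightarrow> y \<in> carrier M \<Longrightarrow> f (x \<oplus>\<^bsub>M\<^esub> y) = f x \<oplus>\<^bsub>N\<^esub> f y"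
    and "\<And>r x. r \<in> carrier K \<Longrightarrow> x \<in> carrier M \<Longrightarrow> f (r \<odot>\<^bsub>M\<^esub> x) = r \<odot>\<^bsub>N\<^esub> f x"
  using assms unfolding linear_maps_def by auto

lemma linear_mapsI:
  assumes "\<And>x. x \<in> carrier M \<Longrightarrow> f x \<in> carrier N"
    and "\<And>x y. x \<in> carrier M \<Longrightarrow> y \<in> carrier M \<Longrightarrow> f (x \<oplus>\<^bsub>M\<^esub> y) = f x \<oplus>\<^bsub>N\<^esub> f y"
    and "\<And>r x. r \<in> carrier K \<Longrightarrow> x \<in> carrier M \<Longrightarrow> f (r \<odot>\<^bsub>M\<^esub> x) = r \<odot>\<^bsub>N\<^esub> f x"
  shows "f \<in> linear_maps K M N"
  using assms unfolding linear_maps_def by auto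

lemma linear_maps_comp:
  assumes "f \<in> linear_maps K M N" "g \<in> linear_maps K N P"
  shows "(\<lambda>x. g (f x)) \<in> linear_maps K M P"
  using assms by (auto intro!: linear_mapsI simp: linear_mapsD)

lemma linear_maps_zero:
  assumes M: "module K M" and N: "module K N" and f: "f \<in> linear_maps K M N"
  shows "f \<zero>\<^bsub>M\<^esub> = \<zero>\<^bsub>N\<^esub>"
proof -
  interpret M: module K M by fact
  interpret N: module K N by fact
  have "f \<zero>\<^bsub>M\<^esub> = f (\<zero>\<^bsub>K\<^esub> \<odot>\<^bsub>M\<^esub> \<zero>\<^bsub>M\<^esub>)" by simp
  also have "\<dots> = \<zero>\<^bsub>K\<^esub> \<odot>\<^bsub>N\<^esub> f \<zero>\<^bsub>M\<^esub>" using f by (intro linear_mapsD(3)) auto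
  also have "\<dots> = \<zero>\<^bsub>N\<^esub>" using linear_mapsD(1)[OF f] by simp
  finally show ?thesis .
qed

lemma linear_maps_minus:
  assumes M: "module K M" and N: "module K N" and f: "f \<in> linear_maps K M N"
    and x: "x \<in> carrier M" and y: "y \<in> carrier M"
  shows "f (x \<ominus>\<^bsub>M\<^esub> y) = f x \<ominus>\<^bsub>N\<^esub> f y"
proof -
  interpret M: module K M by fact
  interpret N: module K N by fact
  have "f (x \<ominus>\<^bsub>M\<^esub> y) = f x \<oplus>\<^bsub>N\<^esub> f ((\<ominus>\<^bsub>K\<^esub> \<one>\<^bsub>K\<^esub>) \<odot>\<^bsub>M\<^esub> y)"
    using x y by (simp add: a_minus_def M.smult_l_minus linear_mapsD(2)[OF f])
  also have "f ((\<ominus>\<^bsub>K\<^esub> \<one>\<^bsub>K\<^esub>) \<odot>\<^bsub>M\<^esub> y) = (\<ominus>\<^bsub>K\<^esub> \<one>\<^bsub>K\<^esub>) \<odot>\<^bsub>N\<^esub> f y"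
    using y by (intro linear_mapsD(3)[OF f]) auto
  also have "\<dots> = \<ominus>\<^bsub>N\<^esub> f y"
    using linear_mapsD(1)[OF f y] by (simp add: N.smult_l_minus)
  finally show ?thesis by (simp add: a_minus_def)
qed

lemma equalizer_submodule:
  assumes M: "module K M" and N: "module K N"
    and f: "f \<in> linear_maps K M N" and g: "g \<in> linear_maps K M N"
  shows "submodule {x \<in> carrier M. f x = g x} K M"
proof -
  interpret M: module K M by fact
  interpret N: module K N by fact
  have inv: "f (\<ominus>\<^bsub>M\<^esub> x) = g (\<ominus>\<^bsub>M\<^esub> x)" if "x \<in> carrier M" "f x = g x" for x
    using linear_maps_minus[OF M N f M.zero_closed that(1)] linear_maps_minus[OF M N g M.zero_closed that(1)]
      that linear_maps_zero[OF M N f] linear_maps_zero[OF M N g]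
    by (simp add: a_minus_def)
  show ?thesis
    by (rule M.submoduleI)
      (auto simp: linear_maps_zero[OF M N f] linear_maps_zero[OF M N g] inv
        linear_mapsD(2,3)[OF f] linear_mapsD(2,3)[OF g])
qed

lemma zero_linear_map:
  assumes "module K N"
  shows "(\<lambda>x. \<zero>\<^bsub>N\<^esub>) \<in> linear_maps K M N"
proof -
  interpret N: module K N by fact
  show ?thesis by (rule linear_mapsI) auto
qed

lemma free_module_simps:
  "carrier (free_module K X) = {f. (\<forall>x. f x \<in> carrier K) \<and> (\<forall>x. x \<notin> X \<longrightarrow> f x = \<zero>\<^bsub>K\<^esub>) \<and> finite {x. f x \<noteq> \<zero>\<^bsub>K\<^esub>}}"
  "zero (free_module K X) = (\<lambda>x. \<zero>\<^bsub>K\<^esub>)"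
  "add (free_module K X) = (\<lambda>f g x. f x \<oplus>\<^bsub>K\<^esub> g x)"
  "smult (free_module K X) = (\<lambda>r f x. r \<otimes>\<^bsub>K\<^esub> f x)"
  by (auto simp: free_module_def)

lemma module_free_module:
  assumes "cring K"
  shows "module K (free_module K X)"
proof -
  interpret cring K by fact
  have fin: "finite {x. f x \<oplus>\<^bsub>K\<^esub> g x \<noteq> \<zero>\<^bsub>K\<^esub>}" if "finite {x. f x \<noteq> \<zero>\<^bsub>K\<^esub>}" "finite {x. g x \<noteq> \<zero>\<^bsub>K\<^esub>}" 
    for f g :: "_ \<Rightarrow> _"
    by (rule finite_subset[OF _ finite_UnI[OF that]]) auto
  have fin2: "finite {x. r \<otimes>\<^bsub>K\<^esub> g x \<noteq> \<zero>\<^bsub>K\<^esub>}" if "finite {x. g x \<noteq> \<zero>\<^bsub>K\<^esub>}" "r \<in> carrier K"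
    for r and g :: "_ \<Rightarrow> _"
    by (rule finite_subset[OF _ that(1)]) (use that in auto)
  have inv: "\<exists>y\<in>carrier (free_module K X). y \<oplus>\<^bsub>free_module K X\<^esub> f = \<zero>\<^bsub>free_module K X\<^esub>"
    if "f \<in> carrier (free_module K X)" for f
  proof
    have "finite {x. \<ominus>\<^bsub>K\<^esub> f x \<noteq> \<zero>\<^bsub>K\<^esub>}" 
      by (rule finite_subset[of _ "{x. f x \<noteq> \<zero>\<^bsub>K\<^esub>}"]) (use that in \<open>auto simp: free_module_simps\<close>)
    then show "(\<lambda>x. \<ominus>\<^bsub>K\<^esub> f x) \<in> carrier (free_module K X)"
      using that by (auto simp: free_module_simps)
  qed (use that in \<open>auto simp: free_module_simps l_neg\<close>)
  have ag: "abelian_group (free_module K X)"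
    by (rule abelian_groupI) (use inv in \<open>auto simp: free_module_simps fin a_ac\<close>)
  show ?thesis
    by (rule moduleI[OF assms ag]) (auto simp: free_module_simps fin2 l_distr r_distr m_assoc)
qed

lemma free_gen_closed:
  assumes "cring K" "x \<in> X"
  shows "free_gen K x \<in> carrier (free_module K X)"
proof -
  interpret cring K by fact
  have "finite {y. free_gen K x y \<noteq> \<zero>\<^bsub>K\<^esub>}"
    by (rule finite_subset[of _ "{x}"]) (auto simp: free_gen_def)
  then show ?thesis using assms(2) by (auto simp: free_module_simps free_gen_def)
qed

lemma free_module_induct:
  assumes K: "cring K" and H: "submodule H K (free_module K X)"
    and gen: "\<And>x. x \<in> X \<Longrightarrow> free_gen K x \<in> H" and f: "f \<in> carrier (free_module K X)"
  shows "f \<in> H"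
proof -
  interpret cring K by fact
  let ?F = "free_module K X"
  interpret F: module K ?F by (rule module_free_module[OF K])
  have "f \<in> H" if "f \<in> carrier ?F" "finite S" "{x. f x \<noteq> \<zero>\<^bsub>K\<^esub>} \<subseteq> S" for f S
    using that(2,1,3)
  proof (induction S arbitrary: f rule: finite_induct)
    case empty
    then have "f = \<zero>\<^bsub>?F\<^esub>" by (auto simp: free_module_simps)
    moreover have "\<zero>\<^bsub>?F\<^esub> \<in> H"
      using subgroup.one_closed[OF submodule.axioms(1)[OF H]] by simp
    ultimately show ?case by simp
  next
    case (insert x S)
    show ?case
    proof (cases "f x = \<zero>\<^bsub>K\<^esub>")
      case True
      then show ?thesis using insert by (intro insert.IH) auto
    next
      case False
      let ?g = "f(x := \<zero>\<^bsub>K\<^esub>)"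
      from False insert.prems have x: "x \<in> X" by (auto simp: free_module_simps)
      have "finite {y. ?g y \<noteq> \<zero>\<^bsub>K\<^esub>}"
        by (rule finite_subset[OF _ insert.hyps(1)]) (use insert.prems in auto)
      then have "?g \<in> carrier ?F" using insert.prems by (auto simp: free_module_simps)
      then have g: "?g \<in> H" by (rule insert.IH) (use insert.prems in auto)
      have fx: "f x \<in> carrier K" using insert.prems by (auto simp: free_module_simps)
      have "f = f x \<odot>\<^bsub>?F\<^esub> free_gen K x \<oplus>\<^bsub>?F\<^esub> ?g"
        using insert.prems by (auto simp: free_module_simps free_gen_def)
      also have "\<dots> \<in> H"
        using F.submoduleE(4)[OF H fx gen[OF x]] g by (rule F.submoduleE(5)[OF H])
      finally show ?thesis .
    qed
  qed
  then show ?thesis using f by (auto simp: free_module_simps)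
qed

definition lin_ext where
  "lin_ext K P \<beta> f = (\<Oplus>\<^bsub>P\<^esub>x\<in>{x. f x \<noteq> \<zero>\<^bsub>K\<^esub>}. f x \<odot>\<^bsub>P\<^esub> \<beta> x)"

lemma lin_ext:
  assumes P: "module K P" and \<beta>: "\<beta> \<in> X \<rightarrow> carrier P"
  shows "lin_ext K P \<beta> \<in> linear_maps K (free_module K X) P"
    and "\<And>x. x \<in> X \<Longrightarrow> lin_ext K P \<beta> (free_gen K x) = \<beta> x"
proof -
  interpret P: module K P by fact
  let ?F = "free_module K X"
  have K: "cring K" by (rule P.R.is_cring)
  have ext: "lin_ext K P \<beta> f = (\<Oplus>\<^bsub>P\<^esub>x\<in>A. f x \<odot>\<^bsub>P\<^esub> \<beta> x)"
    if "f \<in> carrier ?F" "finite A" "{x. f x \<noteq> \<zero>\<^bsub>K\<^esub>} \<subseteq> A" "A \<subseteq> X" for f A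
    unfolding lin_ext_def
    by (rule P.add.finprod_mono_neutral_cong_left) (use that \<beta> in \<open>auto simp: free_module_simps Pi_iff\<close>)
  have sub: "{x. f x \<noteq> \<zero>\<^bsub>K\<^esub>} \<subseteq> X" "finite {x. f x \<noteq> \<zero>\<^bsub>K\<^esub>}" if "f \<in> carrier ?F" for f
    using that by (auto simp: free_module_simps)
  have cl: "(\<lambda>x. f x \<odot>\<^bsub>P\<^esub> \<beta> x) \<in> A \<rightarrow> carrier P" if "f \<in> carrier ?F" "A \<subseteq> X" for f A
    using that \<beta> by (auto simp: free_module_simps Pi_iff)
  interpret F: module K ?F by (rule module_free_module[OF K])
  show "lin_ext K P \<beta> \<in> linear_maps K ?F P"
  proof (rule linear_mapsI)
    fix f assume "f \<in> carrier ?F"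
    then show "lin_ext K P \<beta> f \<in> carrier P"
      unfolding lin_ext_def by (intro P.finsum_closed cl sub)
  next
    fix f g assume f: "f \<in> carrier ?F" and g: "g \<in> carrier ?F"
    let ?A = "{x. f x \<noteq> \<zero>\<^bsub>K\<^esub>} \<union> {x. g x \<noteq> \<zero>\<^bsub>K\<^esub>}"
    have A: "finite ?A" "?A \<subseteq> X" using sub[OF f] sub[OF g] by auto
    have "lin_ext K P \<beta> (f \<oplus>\<^bsub>?F\<^esub> g) = (\<Oplus>\<^bsub>P\<^esub>x\<in>?A. (f \<oplus>\<^bsub>?F\<^esub> g) x \<odot>\<^bsub>P\<^esub> \<beta> x)"
      using f g A by (intro ext F.M.a_closed) (auto simp: free_module_simps)
    also have "\<dots> = (\<Oplus>\<^bsub>P\<^esub>x\<in>?A. f x \<odot>\<^bsub>P\<^esub> \<beta> x \<oplus>\<^bsub>P\<^esub> g x \<odot>\<^bsub>P\<^esub> \<beta> x)"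
      using f g A \<beta> by (intro P.finsum_cong') 
        (auto simp: free_module_simps Pi_iff subset_iff intro!: P.smult_l_distr)
    also have "\<dots> = (\<Oplus>\<^bsub>P\<^esub>x\<in>?A. f x \<odot>\<^bsub>P\<^esub> \<beta> x) \<oplus>\<^bsub>P\<^esub> (\<Oplus>\<^bsub>P\<^esub>x\<in>?A. g x \<odot>\<^bsub>P\<^esub> \<beta> x)"
      by (intro P.finsum_addf cl f g A)
    also have "\<dots> = lin_ext K P \<beta> f \<oplus>\<^bsub>P\<^esub> lin_ext K P \<beta> g"
      using ext[OF f A(1) _ A(2)] ext[OF g A(1) _ A(2)] by auto
    finally show "lin_ext K P \<beta> (f \<oplus>\<^bsub>?F\<^esub> g) = lin_ext K P \<beta> f \<oplus>\<^bsub>P\<^esub> lin_ext K P \<beta> g" .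
  next
    fix r f assume r: "r \<in> carrier K" and f: "f \<in> carrier ?F"
    let ?A = "{x. f x \<noteq> \<zero>\<^bsub>K\<^esub>}"
    note A = sub[OF f]
    have "lin_ext K P \<beta> (r \<odot>\<^bsub>?F\<^esub> f) = (\<Oplus>\<^bsub>P\<^esub>x\<in>?A. (r \<odot>\<^bsub>?F\<^esub> f) x \<odot>\<^bsub>P\<^esub> \<beta> x)"
      using f r A by (intro ext F.smult_closed) (auto simp: free_module_simps)
    also have "\<dots> = (\<Oplus>\<^bsub>P\<^esub>x\<in>?A. r \<odot>\<^bsub>P\<^esub> (f x \<odot>\<^bsub>P\<^esub> \<beta> x))"
      using f r A \<beta> by (intro P.finsum_cong') 
        (auto simp: free_module_simps Pi_iff subset_iff intro!: P.smult_assoc1)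
    also have "\<dots> = r \<odot>\<^bsub>P\<^esub> lin_ext K P \<beta> f"
      unfolding lin_ext_def by (intro P.finsum_smult_ldistr[symmetric] A r cl f)
    finally show "lin_ext K P \<beta> (r \<odot>\<^bsub>?F\<^esub> f) = r \<odot>\<^bsub>P\<^esub> lin_ext K P \<beta> f" .
  qed
  fix x assume x: "x \<in> X"
  have bx: "\<beta> x \<in> carrier P" using x \<beta> by auto
  have "lin_ext K P \<beta> (free_gen K x) = (\<Oplus>\<^bsub>P\<^esub>y\<in>{x}. free_gen K x y \<odot>\<^bsub>P\<^esub> \<beta> y)"
    using x by (intro ext free_gen_closed K) (auto simp: free_gen_def)
  also have "\<dots> = \<beta> x" using bx by (simp add: free_gen_def)
  finally show "lin_ext K P \<beta> (free_gen K x) = \<beta> x" .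
qed

lemma submodule_submodule_span:
  assumes M: "module K M" and S: "S \<subseteq> carrier M"
  shows "submodule (submodule_span K M S) K M" "S \<subseteq> submodule_span K M S"
    "\<And>H. submodule H K M \<Longrightarrow> S \<subseteq> H \<Longrightarrow> submodule_span K M S \<subseteq> H"
proof -
  interpret M: module K M by fact
  show "submodule (submodule_span K M S) K M"
  proof (rule M.submoduleI)
    show "submodule_span K M S \<subseteq> carrier M"
      using M.carrier_is_submodule S unfolding submodule_span_def by auto
    show "\<zero>\<^bsub>M\<^esub> \<in> submodule_span K M S"
      using subgroup.one_closed[OF submodule.axioms(1)] unfolding submodule_span_def by fastforce
  qed (use M.submoduleE in \<open>auto simp: submodule_span_def\<close>)
qed (auto simp: submodule_span_def)

lemma quotient_module:
  assumes M: "module K M" and H: "submodule H K M"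
  shows "module K (quotient_module M H)"
    and "(\<lambda>x. H +>\<^bsub>M\<^esub> x) \<in> linear_maps K M (quotient_module M H)"
    and "carrier (quotient_module M H) = (\<lambda>x. H +>\<^bsub>M\<^esub> x) ` carrier M"
    and "\<And>x y. x \<in> carrier M \<Longrightarrow> y \<in> carrier M \<Longrightarrow> H +>\<^bsub>M\<^esub> x = H +>\<^bsub>M\<^esub> y \<longleftrightarrow> x \<ominus>\<^bsub>M\<^esub> y \<in> H"
proof -
  interpret M: module K M by fact
  let ?Q = "quotient_module M H"
  have sg: "subgroup H (add_monoid M)" by (rule submodule.axioms(1)[OF H])
  interpret H: abelian_subgroup H M
    by (rule abelian_subgroupI3) (auto simp: additive_subgroup_def sg M.abelian_group_axioms)
  have Hc: "H \<subseteq> carrier M" by (rule H.a_subset)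
  show carr: "carrier ?Q = (\<lambda>x. H +>\<^bsub>M\<^esub> x) ` carrier M"
    by (auto simp: quotient_module_def A_RCOSETS_def')
  have add: "(H +>\<^bsub>M\<^esub> x) \<oplus>\<^bsub>?Q\<^esub> (H +>\<^bsub>M\<^esub> y) = H +>\<^bsub>M\<^esub> (x \<oplus>\<^bsub>M\<^esub> y)"
    if "x \<in> carrier M" "y \<in> carrier M" for x y
    using H.a_rcos_sum[OF that] by (simp add: quotient_module_def)
  have smult: "r \<odot>\<^bsub>?Q\<^esub> (H +>\<^bsub>M\<^esub> x) = H +>\<^bsub>M\<^esub> (r \<odot>\<^bsub>M\<^esub> x)"
    if r: "r \<in> carrier K" and x: "x \<in> carrier M" for r x
  proof -
    have *: "H +>\<^bsub>M\<^esub> (r \<odot>\<^bsub>M\<^esub> y) = H +>\<^bsub>M\<^esub> (r \<odot>\<^bsub>M\<^esub> x)" if "y \<in> H +>\<^bsub>M\<^esub> x" for y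
    proof -
      from that obtain h where h: "h \<in> H" "y = h \<oplus>\<^bsub>M\<^esub> x" by (auto simp: a_r_coset_def')
      then have "r \<odot>\<^bsub>M\<^esub> y = r \<odot>\<^bsub>M\<^esub> h \<oplus>\<^bsub>M\<^esub> r \<odot>\<^bsub>M\<^esub> x"
        using Hc r x by (auto intro: M.smult_r_distr)
      moreover have "r \<odot>\<^bsub>M\<^esub> h \<in> H" using H r h(1) by (simp add: M.submoduleE(4))
      ultimately have "r \<odot>\<^bsub>M\<^esub> y \<in> H +>\<^bsub>M\<^esub> (r \<odot>\<^bsub>M\<^esub> x)" by (auto simp: a_r_coset_def')
      from M.a_repr_independence[OF this _ sg] r x show ?thesis by auto
    qed
    have "r \<odot>\<^bsub>?Q\<^esub> (H +>\<^bsub>M\<^esub> x) = (\<Union>y\<in>H +>\<^bsub>M\<^esub> x. H +>\<^bsub>M\<^esub> (r \<odot>\<^bsub>M\<^esub> y))"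
      by (simp only: quotient_module_def module.simps)
    also have "\<dots> = (\<Union>y\<in>H +>\<^bsub>M\<^esub> x. H +>\<^bsub>M\<^esub> (r \<odot>\<^bsub>M\<^esub> x))"
      by (simp only: * cong: SUP_cong)
    also have "\<dots> = H +>\<^bsub>M\<^esub> (r \<odot>\<^bsub>M\<^esub> x)"
      using H.a_rcos_self[OF x] by blast
    finally show ?thesis .
  qed
  show "(\<lambda>x. H +>\<^bsub>M\<^esub> x) \<in> linear_maps K M ?Q"
    by (rule linear_mapsI) (simp_all only: carr add smult imageI)
  have zero: "\<zero>\<^bsub>?Q\<^esub> = H +>\<^bsub>M\<^esub> \<zero>\<^bsub>M\<^esub>"
    using Hc by (simp add: quotient_module_def)
  have ag: "abelian_group ?Q"
  proof (rule abelian_groupI)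
    fix X assume "X \<in> carrier ?Q"
    then obtain x where x: "x \<in> carrier M" "X = H +>\<^bsub>M\<^esub> x" by (auto simp: carr)
    have "(H +>\<^bsub>M\<^esub> (\<ominus>\<^bsub>M\<^esub> x)) \<oplus>\<^bsub>?Q\<^esub> X = \<zero>\<^bsub>?Q\<^esub>"
      unfolding x(2) zero by (simp only: add x(1) M.a_inv_closed M.l_neg)
    then show "\<exists>Y\<in>carrier ?Q. Y \<oplus>\<^bsub>?Q\<^esub> X = \<zero>\<^bsub>?Q\<^esub>"
      unfolding carr using x(1) by blast
  qed (auto simp: carr zero add M.a_ac)
  show "module K ?Q"
    by (rule moduleI[OF M.R.is_cring ag])
      (auto simp: carr smult add M.smult_l_distr M.smult_r_distr M.smult_assoc1)
  fix x y assume x: "x \<in> carrier M" and y: "y \<in> carrier M"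
  show "H +>\<^bsub>M\<^esub> x = H +>\<^bsub>M\<^esub> y \<longleftrightarrow> x \<ominus>\<^bsub>M\<^esub> y \<in> H"
  proof
    assume "H +>\<^bsub>M\<^esub> x = H +>\<^bsub>M\<^esub> y"
    then have "x \<in> H +>\<^bsub>M\<^esub> y" using H.a_rcos_self[OF x] by simp
    then show "x \<ominus>\<^bsub>M\<^esub> y \<in> H" using x y Hc
      by (auto simp: a_r_coset_def' a_minus_def M.a_assoc M.r_neg subset_iff)
  next
    assume h: "x \<ominus>\<^bsub>M\<^esub> y \<in> H"
    have "(x \<ominus>\<^bsub>M\<^esub> y) \<oplus>\<^bsub>M\<^esub> y = x" using x y by (simp add: a_minus_def M.a_assoc M.l_neg)
    then have "x \<in> H +>\<^bsub>M\<^esub> y" using h by (force simp: a_r_coset_def')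
    from M.a_repr_independence[OF this y sg] show "H +>\<^bsub>M\<^esub> x = H +>\<^bsub>M\<^esub> y" by simp
  qed
qed

lemma tensor_relations_subset:
  assumes M: "module K M" and N: "module K N"
  shows "tensor_relations K M N \<subseteq> carrier (free_module K (carrier M \<times> carrier N))"
proof -
  interpret M: module K M by fact
  interpret N: module K N by fact
  note K = M.R.is_cring
  interpret F: module K "free_module K (carrier M \<times> carrier N)" by (rule module_free_module[OF K])
  show ?thesis
    unfolding tensor_relations_def Let_def
    by (auto intro!: F.M.minus_closed F.M.a_closed F.smult_closed free_gen_closed K)
qed

lemma module_tensor_module:
  assumes M: "module K M" and N: "module K N"
  shows "module K (tensor_module K M N)"
proof -
  interpret M: module K M by fact
  show ?thesis unfolding tensor_module_def tensor_null_def
    by (intro quotient_module(1) module_free_module submodule_submodule_span(1)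
        tensor_relations_subset M N M.R.is_cring)
qed

lemma tensor_bilinear:
  assumes M: "module K M" and N: "module K N"
  shows "tensor K M N \<in> bilinear_maps K M N (tensor_module K M N)"
proof -
  interpret M: module K M by fact
  interpret N: module K N by fact
  note K = M.R.is_cring
  let ?F = "free_module K (carrier M \<times> carrier N)"
  let ?T = "tensor_module K M N"
  let ?H = "tensor_null K M N"
  note F = module_free_module[OF K, of "carrier M \<times> carrier N"]
  interpret F: module K ?F by (rule F)
  note span = submodule_submodule_span[OF F tensor_relations_subset[OF M N], folded tensor_null_def]
  note quo = quotient_module[OF F span(1), folded tensor_module_def]
  have gen: "free_gen K (a, b) \<in> carrier ?F" if "a \<in> carrier M" "b \<in> carrier N" for a b
    using that by (intro free_gen_closed K) auto
  have cl: "tensor K M N a b \<in> carrier ?T" if "a \<in> carrier M" "b \<in> carrier N" for a b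
    unfolding tensor_def using linear_mapsD(1)[OF quo(2) gen[OF that]] by simp
  have eq: "?H +>\<^bsub>?F\<^esub> x = ?H +>\<^bsub>?F\<^esub> y"
    if "x \<ominus>\<^bsub>?F\<^esub> y \<in> tensor_relations K M N" "x \<in> carrier ?F" "y \<in> carrier ?F" for x y
    using quo(4)[OF that(2,3)] span(2) that(1) by blast
  have 1: "tensor K M N (a \<oplus>\<^bsub>M\<^esub> a') b = tensor K M N a b \<oplus>\<^bsub>?T\<^esub> tensor K M N a' b"
    if "a \<in> carrier M" "a' \<in> carrier M" "b \<in> carrier N" for a a' b
    unfolding tensor_def using that
    by (subst linear_mapsD(2)[OF quo(2), symmetric], simp_all add: gen)
      (rule eq, unfold tensor_relations_def Let_def, blast, simp_all add: gen)
  have 2: "tensor K M N a (b \<oplus>\<^bsub>N\<^esub> b') = tensor K M N a b \<oplus>\<^bsub>?T\<^esub> tensor K M N a b'"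
    if "a \<in> carrier M" "b \<in> carrier N" "b' \<in> carrier N" for a b b'
    unfolding tensor_def using that
    by (subst linear_mapsD(2)[OF quo(2), symmetric], simp_all add: gen)
      (rule eq, unfold tensor_relations_def Let_def, blast, simp_all add: gen)
  have 3: "tensor K M N (r \<odot>\<^bsub>M\<^esub> a) b = r \<odot>\<^bsub>?T\<^esub> tensor K M N a b"
    if "a \<in> carrier M" "r \<in> carrier K" "b \<in> carrier N" for a r b
    unfolding tensor_def using that
    by (subst linear_mapsD(3)[OF quo(2), symmetric], simp_all add: gen)
      (rule eq, unfold tensor_relations_def Let_def, blast, simp_all add: gen)
  have 4: "tensor K M N a (r \<odot>\<^bsub>N\<^esub> b) = r \<odot>\<^bsub>?T\<^esub> tensor K M N a b"
    if "a \<in> carrier M" "r \<in> carrier K" "b \<in> carrier N" for a r b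
    unfolding tensor_def using that
    by (subst linear_mapsD(3)[OF quo(2), symmetric], simp_all add: gen)
      (rule eq, unfold tensor_relations_def Let_def, blast, simp_all add: gen)
  show ?thesis unfolding bilinear_maps_def
    by (auto intro!: linear_mapsI cl simp: 1 2 3 4)
qed

theorem tensor_universal:
  assumes M: "module K M" and N: "module K N" and P: "module K P"
    and \<beta>: "\<beta> \<in> bilinear_maps K M N P"
  shows "\<exists>!h. h \<in> linear_maps K (tensor_module K M N) P \<inter> extensional (carrier (tensor_module K M N)) \<and>
       (\<forall>a\<in>carrier M. \<forall>b\<in>carrier N. h (tensor K M N a b) = \<beta> a b)"
proof -
  interpret M: module K M by fact
  interpret N: module K N by fact
  interpret P: module K P by fact
  note K = M.R.is_cring
  let ?X = "carrier M \<times> carrier N"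
  let ?F = "free_module K ?X"
  let ?T = "tensor_module K M N"
  let ?H = "tensor_null K M N"
  note F = module_free_module[OF K, of ?X]
  interpret F: module K ?F by (rule F)
  note span = submodule_submodule_span[OF F tensor_relations_subset[OF M N], folded tensor_null_def]
  note quo = quotient_module[OF F span(1), folded tensor_module_def]
  have \<beta>1: "\<beta> a \<in> linear_maps K N P" if "a \<in> carrier M" for a
    using \<beta> that by (auto simp: bilinear_maps_def)
  have \<beta>2: "(\<lambda>a. \<beta> a b) \<in> linear_maps K M P" if "b \<in> carrier N" for b
    using \<beta> that by (auto simp: bilinear_maps_def)
  have diff0: "u \<ominus>\<^bsub>P\<^esub> v = \<zero>\<^bsub>P\<^esub> \<longleftrightarrow> u = v" if "u \<in> carrier P" "v \<in> carrier P" for u v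
    using that by (metis P.M.add.inv_solve_right P.M.add.inv_closed P.M.l_zero P.M.zero_closed a_minus_def)
  let ?\<phi> = "lin_ext K P (\<lambda>(a, b). \<beta> a b)"
  have \<phi>: "?\<phi> \<in> linear_maps K ?F P"
    "\<And>a b. a \<in> carrier M \<Longrightarrow> b \<in> carrier N \<Longrightarrow> ?\<phi> (free_gen K (a, b)) = \<beta> a b"
    using lin_ext[OF P, of "\<lambda>(a, b). \<beta> a b" ?X] linear_mapsD(1)[OF \<beta>1] by (auto simp: Pi_iff)
  have gen: "free_gen K (a, b) \<in> carrier ?F" if "a \<in> carrier M" "b \<in> carrier N" for a b
    using that by (intro free_gen_closed K) auto
  have cl: "\<beta> a b \<in> carrier P" if "a \<in> carrier M" "b \<in> carrier N" for a b
    using linear_mapsD(1)[OF \<beta>1] that by auto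
  have "tensor_relations K M N \<subseteq> {x \<in> carrier ?F. ?\<phi> x = \<zero>\<^bsub>P\<^esub>}"
  proof
    fix x assume x: "x \<in> tensor_relations K M N"
    then have xF: "x \<in> carrier ?F" using tensor_relations_subset[OF M N] by auto
    have "?\<phi> x = \<zero>\<^bsub>P\<^esub>"
      using x unfolding tensor_relations_def Let_def
      apply (elim UnE CollectE exE conjE)
         apply (simp_all add: linear_maps_minus[OF F P \<phi>(1)] gen \<phi>(2) F.M.a_closed F.smult_closed
          linear_mapsD(2,3)[OF \<phi>(1)] linear_mapsD(2,3)[OF \<beta>1] linear_mapsD(2,3)[OF \<beta>2] cl)
         apply (simp_all add: a_minus_def P.M.r_neg cl)
      done
    with xF show "x \<in> {x \<in> carrier ?F. ?\<phi> x = \<zero>\<^bsub>P\<^esub>}" by simp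
  qed
  then have null: "?H \<subseteq> {x \<in> carrier ?F. ?\<phi> x = \<zero>\<^bsub>P\<^esub>}"
    by (rule span(3)[OF equalizer_submodule[OF F P \<phi>(1) zero_linear_map[OF P]]])
  have wd: "?\<phi> x = ?\<phi> y" if "x \<in> carrier ?F" "y \<in> carrier ?F" "?H +>\<^bsub>?F\<^esub> x = ?H +>\<^bsub>?F\<^esub> y" for x y
  proof -
    have "?\<phi> (x \<ominus>\<^bsub>?F\<^esub> y) = \<zero>\<^bsub>P\<^esub>" using quo(4)[OF that(1,2)] that(3) null by auto
    then show ?thesis
      using that linear_mapsD(1)[OF \<phi>(1)] by (simp add: linear_maps_minus[OF F P \<phi>(1)] diff0)
  qed
  define h where "h = restrict (\<lambda>X. ?\<phi> (SOME x. x \<in> carrier ?F \<and> X = ?H +>\<^bsub>?F\<^esub> x)) (carrier ?T)"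
  have h: "h (?H +>\<^bsub>?F\<^esub> x) = ?\<phi> x" if "x \<in> carrier ?F" for x
  proof -
    let ?y = "SOME y. y \<in> carrier ?F \<and> ?H +>\<^bsub>?F\<^esub> x = ?H +>\<^bsub>?F\<^esub> y"
    have "?y \<in> carrier ?F \<and> ?H +>\<^bsub>?F\<^esub> x = ?H +>\<^bsub>?F\<^esub> ?y" by (rule someI[of _ x]) (use that in simp)
    then have "?\<phi> x = ?\<phi> ?y" using wd that by blast
    moreover have "?H +>\<^bsub>?F\<^esub> x \<in> carrier ?T" using that quo(3) by auto
    ultimately show ?thesis by (simp add: h_def)
  qed
  have addq: "(?H +>\<^bsub>?F\<^esub> x) \<oplus>\<^bsub>?T\<^esub> (?H +>\<^bsub>?F\<^esub> y) = ?H +>\<^bsub>?F\<^esub> (x \<oplus>\<^bsub>?F\<^esub> y)"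
    if "x \<in> carrier ?F" "y \<in> carrier ?F" for x y
    using linear_mapsD(2)[OF quo(2) that] by simp
  have smultq: "r \<odot>\<^bsub>?T\<^esub> (?H +>\<^bsub>?F\<^esub> x) = ?H +>\<^bsub>?F\<^esub> (r \<odot>\<^bsub>?F\<^esub> x)"
    if "r \<in> carrier K" "x \<in> carrier ?F" for r x
    using linear_mapsD(3)[OF quo(2) that] by simp
  have hlin: "h \<in> linear_maps K ?T P"
    by (rule linear_mapsI)
      (auto simp: quo(3) h addq smultq linear_mapsD[OF \<phi>(1)] F.M.a_closed F.smult_closed)
  show ?thesis
  proof (rule ex1I[of _ h])
    show "h \<in> linear_maps K ?T P \<inter> extensional (carrier ?T) \<and>
       (\<forall>a\<in>carrier M. \<forall>b\<in>carrier N. h (tensor K M N a b) = \<beta> a b)"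
      using hlin by (auto simp: tensor_def h gen \<phi>(2)) (simp add: h_def)
  next
    fix g assume g: "g \<in> linear_maps K ?T P \<inter> extensional (carrier ?T) \<and>
       (\<forall>a\<in>carrier M. \<forall>b\<in>carrier N. g (tensor K M N a b) = \<beta> a b)"
    then have glin: "g \<in> linear_maps K ?T P" by simp
    note T = module_tensor_module[OF M N]
    have gq: "(\<lambda>x. g (?H +>\<^bsub>?F\<^esub> x)) \<in> linear_maps K ?F P"
      by (rule linear_maps_comp[OF quo(2) glin])
    have "x \<in> {x \<in> carrier ?F. g (?H +>\<^bsub>?F\<^esub> x) = ?\<phi> x}" if "x \<in> carrier ?F" for x
    proof (rule free_module_induct[OF K equalizer_submodule[OF F P gq \<phi>(1)] _ that])
      fix y assume "y \<in> ?X"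
      then obtain a b where y: "y = (a, b)" "a \<in> carrier M" "b \<in> carrier N" by blast
      have "g (tensor K M N a b) = \<beta> a b" using g y(2,3) by blast
      then show "free_gen K y \<in> {x \<in> carrier ?F. g (?H +>\<^bsub>?F\<^esub> x) = ?\<phi> x}"
        using gen[OF y(2,3)] \<phi>(2)[OF y(2,3)] by (simp add: y(1) tensor_def)
    qed
    then have all: "g (?H +>\<^bsub>?F\<^esub> x) = ?\<phi> x" if "x \<in> carrier ?F" for x
      using that by blast
    show "g = h"
    proof
      fix X show "g X = h X"
      proof (cases "X \<in> carrier ?T")
        case True
        then show ?thesis using all h quo(3) by auto
      next
        case False
        then show ?thesis using g by (simp add: h_def extensional_def)
      qed
    qed
  qed
qed

lemma tensor_lift:
  assumes "module K M" "module K N" "module K P" "\<beta> \<in> bilinear_maps K M N P"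
  shows "tensor_lift K M N P \<beta> \<in> linear_maps K (tensor_module K M N) P"
    and "\<And>a b. a \<in> carrier M \<Longrightarrow> b \<in> carrier N \<Longrightarrow>
      tensor_lift K M N P \<beta> (tensor K M N a b) = \<beta> a b"
  using theI'[OF tensor_universal[OF assms], folded tensor_lift_def] by auto

lemma linear_maps_add:
  assumes N: "module K N" and f: "f \<in> linear_maps K M N" and g: "g \<in> linear_maps K M N"
  shows "(\<lambda>x. f x \<oplus>\<^bsub>N\<^esub> g x) \<in> linear_maps K M N"
proof -
  interpret N: module K N by fact
  show ?thesis
    by (rule linear_mapsI) (auto simp: linear_mapsD[OF f] linear_mapsD[OF g] N.smult_r_distr N.M.a_ac)
qed

lemma linear_maps_smult:
  assumes N: "module K N" and f: "f \<in> linear_maps K M N" and r: "r \<in> carrier K"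
  shows "(\<lambda>x. r \<odot>\<^bsub>N\<^esub> f x) \<in> linear_maps K M N"
proof -
  interpret N: module K N by fact
  have *: "r \<odot>\<^bsub>N\<^esub> (s \<odot>\<^bsub>N\<^esub> y) = s \<odot>\<^bsub>N\<^esub> (r \<odot>\<^bsub>N\<^esub> y)" if "s \<in> carrier K" "y \<in> carrier N" for s y
    using that r by (simp add: N.smult_assoc1[symmetric] N.R.m_comm)
  show ?thesis
    by (rule linear_mapsI) (auto simp: linear_mapsD[OF f] r N.smult_r_distr *)
qed

lemma tensor_closed:
  assumes "module K M" "module K N" "a \<in> carrier M" "b \<in> carrier N"
  shows "tensor K M N a b \<in> carrier (tensor_module K M N)"
  using tensor_bilinear[OF assms(1,2)] assms(3,4)
  by (auto simp: bilinear_maps_def dest: linear_mapsD(1))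

lemma tensor_linear:
  assumes "module K M" "module K N"
  shows "a \<in> carrier M \<Longrightarrow> tensor K M N a \<in> linear_maps K N (tensor_module K M N)"
    and "b \<in> carrier N \<Longrightarrow> (\<lambda>a. tensor K M N a b) \<in> linear_maps K M (tensor_module K M N)"
  using tensor_bilinear[OF assms] by (auto simp: bilinear_maps_def)

lemma tensor_ext:
  assumes M: "module K M" and N: "module K N" and P: "module K P"
    and g: "g \<in> linear_maps K (tensor_module K M N) P"
    and h: "h \<in> linear_maps K (tensor_module K M N) P"
    and eq: "\<And>a b. a \<in> carrier M \<Longrightarrow> b \<in> carrier N \<Longrightarrow> g (tensor K M N a b) = h (tensor K M N a b)"
    and t: "t \<in> carrier (tensor_module K M N)"
  shows "g t = h t"
proof -
  let ?T = "tensor_module K M N"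
  interpret T: module K ?T by (rule module_tensor_module[OF M N])
  let ?\<beta> = "\<lambda>a b. g (tensor K M N a b)"
  have \<beta>: "?\<beta> \<in> bilinear_maps K M N P"
    using linear_maps_comp[OF tensor_linear(1)[OF M N] g] linear_maps_comp[OF tensor_linear(2)[OF M N] g]
    by (auto simp: bilinear_maps_def)
  have r: "restrict f (carrier ?T) \<in> linear_maps K ?T P" if "f \<in> linear_maps K ?T P" for f
    by (rule linear_mapsI) (auto simp: linear_mapsD[OF that])
  let ?Q = "\<lambda>k. k \<in> linear_maps K ?T P \<inter> extensional (carrier ?T) \<and>
    (\<forall>a\<in>carrier M. \<forall>b\<in>carrier N. k (tensor K M N a b) = ?\<beta> a b)"
  have "?Q (restrict g (carrier ?T))" "?Q (restrict h (carrier ?T))"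
    using r[OF g] r[OF h] eq tensor_closed[OF M N] by auto
  then have "restrict g (carrier ?T) = restrict h (carrier ?T)"
    by (metis (no_types, lifting) the1_equality[OF tensor_universal[OF M N P \<beta>]])
  from fun_cong[OF this, of t] t show ?thesis by simp
qed

lemma tensor_map:
  assumes M: "module K M" and N: "module K N" and M': "module K M'" and N': "module K N'"
    and f: "f \<in> linear_maps K M M'" and g: "g \<in> linear_maps K N N'"
  shows "tensor_map K M N M' N' f g \<in> linear_maps K (tensor_module K M N) (tensor_module K M' N')"
    and "\<And>a b. a \<in> carrier M \<Longrightarrow> b \<in> carrier N \<Longrightarrow>
      tensor_map K M N M' N' f g (tensor K M N a b) = tensor K M' N' (f a) (g b)"
proof -
  have "(\<lambda>a b. tensor K M' N' (f a) (g b)) \<in> bilinear_maps K M N (tensor_module K M' N')"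
    using linear_maps_comp[OF g tensor_linear(1)[OF M' N']] linear_maps_comp[OF f tensor_linear(2)[OF M' N']]
      linear_mapsD(1)[OF f] linear_mapsD(1)[OF g]
    by (auto simp: bilinear_maps_def)
  note * = tensor_lift[OF M N module_tensor_module[OF M' N'] this, folded tensor_map_def]
  show "tensor_map K M N M' N' f g \<in> linear_maps K (tensor_module K M N) (tensor_module K M' N')"
    and "\<And>a b. a \<in> carrier M \<Longrightarrow> b \<in> carrier N \<Longrightarrow>
      tensor_map K M N M' N' f g (tensor K M N a b) = tensor K M' N' (f a) (g b)"
    by (fact *)+
qed

lemma tensor_lift_linear:
  assumes M: "module K M" and N: "module K N" and P: "module K P" and Q: "module K Q"
    and \<beta>: "\<And>c. c \<in> carrier P \<Longrightarrow> \<beta> c \<in> bilinear_maps K M N Q"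
    and lin: "\<And>a b. a \<in> carrier M \<Longrightarrow> b \<in> carrier N \<Longrightarrow> (\<lambda>c. \<beta> c a b) \<in> linear_maps K P Q"
    and t: "t \<in> carrier (tensor_module K M N)"
  shows "(\<lambda>c. tensor_lift K M N Q (\<beta> c) t) \<in> linear_maps K P Q"
proof (rule linear_mapsI)
  interpret P: module K P by fact
  note L = tensor_lift[OF M N Q \<beta>]
  show "tensor_lift K M N Q (\<beta> c) t \<in> carrier Q" if "c \<in> carrier P" for c
    by (rule linear_mapsD(1)[OF L(1)[OF that] t])
  show "tensor_lift K M N Q (\<beta> (c \<oplus>\<^bsub>P\<^esub> d)) t =
      tensor_lift K M N Q (\<beta> c) t \<oplus>\<^bsub>Q\<^esub> tensor_lift K M N Q (\<beta> d) t"
    if c: "c \<in> carrier P" and d: "d \<in> carrier P" for c d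
    by (rule tensor_ext[OF M N Q _ _ _ t])
      (auto intro!: L(1) linear_maps_add Q c d simp: L(2) c d linear_mapsD(2)[OF lin])
  show "tensor_lift K M N Q (\<beta> (r \<odot>\<^bsub>P\<^esub> c)) t = r \<odot>\<^bsub>Q\<^esub> tensor_lift K M N Q (\<beta> c) t"
    if r: "r \<in> carrier K" and c: "c \<in> carrier P" for r c
    by (rule tensor_ext[OF M N Q _ _ _ t])
      (auto intro!: L(1) linear_maps_smult Q c r simp: L(2) c r linear_mapsD(3)[OF lin])
qed

lemma tensor_assoc:
  assumes M: "module K M" and N: "module K N" and P: "module K P"
  shows "tensor_assoc K M N P \<in> linear_maps K
      (tensor_module K (tensor_module K M N) P) (tensor_module K M (tensor_module K N P))"
    and "\<And>a b c. a \<in> carrier M \<Longrightarrow> b \<in> carrier N \<Longrightarrow> c \<in> carrier P \<Longrightarrow>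
      tensor_assoc K M N P (tensor K (tensor_module K M N) P (tensor K M N a b) c) =
      tensor K M (tensor_module K N P) a (tensor K N P b c)"
proof -
  let ?NP = "tensor_module K N P" and ?MN = "tensor_module K M N"
  let ?T = "tensor_module K M ?NP"
  note NP = module_tensor_module[OF N P] and MN = module_tensor_module[OF M N]
  note T = module_tensor_module[OF M NP]
  let ?\<beta> = "\<lambda>c a b. tensor K M ?NP a (tensor K N P b c)"
  have \<beta>: "?\<beta> c \<in> bilinear_maps K M N ?T" if c: "c \<in> carrier P" for c
    unfolding bilinear_maps_def using c
    by (auto intro!: linear_maps_comp[OF tensor_linear(2)[OF N P] tensor_linear(1)[OF M NP]]
        tensor_linear(2)[OF M NP] tensor_closed N P)
  have lin: "(\<lambda>c. ?\<beta> c a b) \<in> linear_maps K P ?T" if "a \<in> carrier M" "b \<in> carrier N" for a b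
    by (rule linear_maps_comp[OF tensor_linear(1)[OF N P] tensor_linear(1)[OF M NP]]) (use that in auto)
  note L = tensor_lift[OF M N T \<beta>]
  have bil: "(\<lambda>t c. tensor_lift K M N ?T (?\<beta> c) t) \<in> bilinear_maps K ?MN P ?T"
    unfolding bilinear_maps_def using L(1) tensor_lift_linear[OF M N P T \<beta> lin] by auto
  note A = tensor_lift[OF MN P T bil, folded tensor_assoc_def[unfolded Let_def]]
  show "tensor_assoc K M N P \<in> linear_maps K (tensor_module K ?MN P) ?T" by (rule A(1))
  show "tensor_assoc K M N P (tensor K ?MN P (tensor K M N a b) c) = tensor K M ?NP a (tensor K N P b c)"
    if "a \<in> carrier M" "b \<in> carrier N" "c \<in> carrier P" for a b c
    using that by (simp add: A(2) L(2) tensor_closed M N)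
qed

lemma tensor_assoc_inv:
  assumes M: "module K M" and N: "module K N" and P: "module K P"
  shows "tensor_assoc_inv K M N P \<in> linear_maps K
      (tensor_module K M (tensor_module K N P)) (tensor_module K (tensor_module K M N) P)"
    and "\<And>a b c. a \<in> carrier M \<Longrightarrow> b \<in> carrier N \<Longrightarrow> c \<in> carrier P \<Longrightarrow>
      tensor_assoc_inv K M N P (tensor K M (tensor_module K N P) a (tensor K N P b c)) =
      tensor K (tensor_module K M N) P (tensor K M N a b) c"
proof -
  let ?NP = "tensor_module K N P" and ?MN = "tensor_module K M N"
  let ?T = "tensor_module K ?MN P"
  note NP = module_tensor_module[OF N P] and MN = module_tensor_module[OF M N]
  note T = module_tensor_module[OF MN P]
  let ?\<beta> = "\<lambda>a b c. tensor K ?MN P (tensor K M N a b) c"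
  have \<beta>: "?\<beta> a \<in> bilinear_maps K N P ?T" if a: "a \<in> carrier M" for a
    unfolding bilinear_maps_def using a
    by (auto intro!: linear_maps_comp[OF tensor_linear(1)[OF M N] tensor_linear(2)[OF MN P]]
        tensor_linear(1)[OF MN P] tensor_closed M N)
  have lin: "(\<lambda>a. ?\<beta> a b c) \<in> linear_maps K M ?T" if "b \<in> carrier N" "c \<in> carrier P" for b c
    by (rule linear_maps_comp[OF tensor_linear(2)[OF M N] tensor_linear(2)[OF MN P]]) (use that in auto)
  note L = tensor_lift[OF N P T \<beta>]
  have bil: "(\<lambda>a t. tensor_lift K N P ?T (?\<beta> a) t) \<in> bilinear_maps K M ?NP ?T"
    unfolding bilinear_maps_def using L(1) tensor_lift_linear[OF N P M T \<beta> lin] by auto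
  note A = tensor_lift[OF M NP T bil, folded tensor_assoc_inv_def[unfolded Let_def]]
  show "tensor_assoc_inv K M N P \<in> linear_maps K (tensor_module K M ?NP) ?T" by (rule A(1))
  show "tensor_assoc_inv K M N P (tensor K M ?NP a (tensor K N P b c)) = tensor K ?MN P (tensor K M N a b) c"
    if "a \<in> carrier M" "b \<in> carrier N" "c \<in> carrier P" for a b c
    using that by (simp add: A(2) L(2) tensor_closed N P)
qed

lemma (in hom_coalgebra) hybe_map_bilinear:
  assumes l: "l \<in> carrier K" and n: "\<nu> \<in> carrier K"
  defines "T \<equiv> tensor_module K C C"
  shows "(\<lambda>a b. ((l \<otimes>\<^bsub>K\<^esub> \<epsilon> a) \<odot>\<^bsub>T\<^esub> \<Delta> b \<oplus>\<^bsub>T\<^esub> (\<nu> \<otimes>\<^bsub>K\<^esub> \<epsilon> b) \<odot>\<^bsub>T\<^esub> \<Delta> a)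
      \<ominus>\<^bsub>T\<^esub> l \<odot>\<^bsub>T\<^esub> tensor K C C (\<alpha> a) (\<alpha> b)) \<in> bilinear_maps K C C T"
proof -
  note C = vector_space_C
  have T: "module K T" unfolding T_def by (rule module_tensor_module[OF C C])
  interpret C: module K C by (rule C)
  interpret T: module K T by (rule T)
  have e: "\<epsilon> x \<in> carrier K" "\<epsilon> (x \<oplus>\<^bsub>C\<^esub> y) = \<epsilon> x \<oplus>\<^bsub>K\<^esub> \<epsilon> y" "\<epsilon> (r \<odot>\<^bsub>C\<^esub> x) = r \<otimes>\<^bsub>K\<^esub> \<epsilon> x"
    if "x \<in> carrier C" "y \<in> carrier C" "r \<in> carrier K" for x y r
    using linear_mapsD[OF \<epsilon>_linear] that by (auto simp: scalars_def)
  note D = linear_mapsD[OF \<Delta>_linear, folded T_def] and A = linear_mapsD[OF \<alpha>_linear]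
  have eps: "(\<lambda>x. (s \<otimes>\<^bsub>K\<^esub> \<epsilon> x) \<odot>\<^bsub>T\<^esub> t) \<in> linear_maps K C T" if "s \<in> carrier K" "t \<in> carrier T" for s t
    by (rule linear_mapsI)
      (use that e in \<open>auto simp: C.R.r_distr T.smult_l_distr T.smult_assoc1[symmetric] C.R.m_ac\<close>)
  have dlt: "(\<lambda>x. s \<odot>\<^bsub>T\<^esub> \<Delta> x) \<in> linear_maps K C T" if "s \<in> carrier K" for s
    by (rule linear_maps_smult[OF T \<Delta>_linear[folded T_def] that])
  have neg: "x \<ominus>\<^bsub>T\<^esub> l \<odot>\<^bsub>T\<^esub> y = x \<oplus>\<^bsub>T\<^esub> (\<ominus>\<^bsub>K\<^esub> l) \<odot>\<^bsub>T\<^esub> y" if "y \<in> carrier T" for x y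
    using that l by (simp add: a_minus_def T.smult_l_minus)
  have tc: "tensor K C C (\<alpha> a) (\<alpha> b) \<in> carrier T" if "a \<in> carrier C" "b \<in> carrier C" for a b
    unfolding T_def using that A(1) by (intro tensor_closed C) auto
  have 3: "(\<lambda>a. tensor K C C (\<alpha> a) (\<alpha> b)) \<in> linear_maps K C T" if "b \<in> carrier C" for b
    using linear_maps_comp[OF \<alpha>_linear tensor_linear(2)[OF C C A(1)[OF that]]] by (simp add: T_def)
  have 4: "(\<lambda>b. tensor K C C (\<alpha> a) (\<alpha> b)) \<in> linear_maps K C T" if "a \<in> carrier C" for a
    using linear_maps_comp[OF \<alpha>_linear tensor_linear(1)[OF C C A(1)[OF that]]] by (simp add: T_def)
  have cong: "f \<in> linear_maps K C T" if "g \<in> linear_maps K C T" "\<And>x. x \<in> carrier C \<Longrightarrow> f x = g x" for f g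
    by (rule linear_mapsI) (auto simp: that(2) linear_mapsD[OF that(1)])
  show ?thesis
    unfolding bilinear_maps_def
  proof (safe, goal_cases)
    case (1 a)
    show ?case
      by (rule cong[OF linear_maps_add[OF T linear_maps_add[OF T dlt[of "l \<otimes>\<^bsub>K\<^esub> \<epsilon> a"] eps[of \<nu> "\<Delta> a"]] linear_maps_smult[OF T 4[of a], of "\<ominus>\<^bsub>K\<^esub> l"]]])
        (use 1 l n e D(1) tc neg C.zero_closed in auto)
  next
    case (2 b)
    show ?case
      by (rule cong[OF linear_maps_add[OF T linear_maps_add[OF T eps[of l "\<Delta> b"] dlt[of "\<nu> \<otimes>\<^bsub>K\<^esub> \<epsilon> b"]] linear_maps_smult[OF T 3[of b], of "\<ominus>\<^bsub>K\<^esub> l"]]])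
        (use 2 l n e D(1) tc neg C.zero_closed in auto)
  qed
qed

end

theory Submission
  imports Defs
begin

text \<open>Write \<open>L(a \<otimes> b) = \<epsilon>(a) b\<close> and \<open>R(a \<otimes> b) = \<epsilon>(b) a\<close> for the two counit contractions and, with
  \<open>\<lambda>\<close> standing for \<open>l\<close>, \<open>f = \<lambda> L + \<nu> R\<close> (\<open>contract\<close>), a map from \<open>C \<otimes> C\<close> to \<open>C\<close>. The Hom-Yang-Baxter map is then
  \<open>B = \<Delta> \<circ> f - \<lambda> (\<alpha> \<otimes> \<alpha>)\<close>. Since \<open>L \<circ> \<Delta> = R \<circ> \<Delta> = \<alpha>\<close>, also \<open>f \<circ> \<Delta> = (\<lambda> + \<nu>) \<alpha>\<close>, so the core
  \<open>\<Delta> \<circ> f\<close> is idempotent up to the twist and the scalar \<open>\<lambda> + \<nu>\<close>. All structure maps commute with the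
  twist, so \<open>A = \<alpha> \<otimes> \<alpha> \<otimes> \<alpha>\<close> behaves like a central element. For \<open>X' = \<alpha> \<otimes> (\<Delta> \<circ> f)\<close>
  (\<open>core_right\<close>) and
  \<open>Y' = (\<Delta> \<circ> f) \<otimes> \<alpha>\<close> (\<open>core_left\<close>) this gives \<open>X'\<^sup>2 = (\<lambda> + \<nu>) A X'\<close> and \<open>Y'\<^sup>2 = (\<lambda> + \<nu>) A Y'\<close>. Expanding the
  Hom-Yang-Baxter equation for \<open>X' - \<lambda> A\<close> and \<open>Y' - \<lambda> A\<close>, the terms symmetric in \<open>X'\<close> and
  \<open>Y'\<close> cancel and what is left is
  \<open>X' Y' X' - \<lambda> \<nu> A\<^sup>2 X' = Y' X' Y' - \<lambda> \<nu> A\<^sup>2 Y'\<close> (\<open>braid_shift\<close>).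

  For this reduced equation put \<open>V = \<alpha> \<otimes> \<Delta>\<close> and \<open>W = \<Delta> \<otimes> \<alpha>\<close>, maps from \<open>C \<otimes> C\<close> to
  \<open>C \<otimes> C \<otimes> C\<close>; then \<open>X'(a \<otimes> t) = V(a \<otimes> f(t))\<close> and \<open>Y'(t \<otimes> c) = W(f(t) \<otimes> c)\<close>. Applying \<open>Y'\<close> to
  an image of \<open>V\<close>, the counit cancels one comultiplication and
  \<open>Y' (V(p \<otimes> q)) = W(\<lambda> \<epsilon>(p) \<Delta>(q) + \<nu> \<alpha>(p) \<otimes> \<alpha>(q))\<close>; symmetrically
  \<open>X' (W(p \<otimes> q)) = V(\<lambda> \<alpha>(p) \<otimes> \<alpha>(q) + \<nu> \<epsilon>(q) \<Delta>(p))\<close>. Coassociativity says \<open>V \<circ> \<Delta> = W \<circ> \<Delta>\<close>.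
  Hence with \<open>y = f(b \<otimes> c)\<close> and \<open>z = f(a \<otimes> b)\<close>, the element
  \<open>(X' Y' X' - \<lambda> \<nu> A\<^sup>2 X')(a \<otimes> b \<otimes> c)\<close> is the image under \<open>V \<circ> \<Delta> \<circ> \<alpha>\<close> of
  \<open>\<lambda>(\<lambda> + \<nu>) \<epsilon>(a) y + \<nu>\<^sup>2 \<epsilon>(y) a\<close>, and \<open>(Y' X' Y' - \<lambda> \<nu> A\<^sup>2 Y')(a \<otimes> b \<otimes> c)\<close> is the image of
  \<open>\<lambda>\<^sup>2 \<epsilon>(z) c + \<nu>(\<lambda> + \<nu>) \<epsilon>(c) z\<close>. Both arguments equal \<open>\<lambda> + \<nu>\<close> times
  \<open>\<lambda>\<^sup>2 \<epsilon>(a) \<epsilon>(b) c + \<lambda> \<nu> \<epsilon>(a) \<epsilon>(c) b + \<nu>\<^sup>2 \<epsilon>(b) \<epsilon>(c) a\<close> (\<open>residue_symmetric\<close>).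

  Sweedler computations appear below as identities of linear maps that are verified on pure tensors
  and then evaluated at \<open>\<Delta>(c)\<close>.\<close>

section \<open>Braid relations for operators shifted by a central operator\<close>

text \<open>In \<open>(R + m A)(L + m A)(R + m A)\<close> the terms linear in \<open>m\<close> are \<open>R L A + L R A\<close>, symmetric in \<open>R\<close> and
  \<open>L\<close>, and \<open>m A R\<^sup>2 = m s A\<^sup>2 R\<close>; the quadratic ones are \<open>m\<^sup>2 A\<^sup>2 (2 R + L)\<close>. Apart from \<open>R L R\<close> and the
  symmetric terms there remains \<open>(m s + m\<^sup>2) A\<^sup>2 R\<close>, whose coefficient is the negative of \<open>k\<close>. The
  hypothesis \<open>braid\<close> has \<open>k A\<^sup>2 L\<close> and \<open>k A\<^sup>2 R\<close> moved to the opposite sides, which avoids subtraction.\<close>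

lemma braid_shift:
  assumes T: "module K T"
    and R: "R \<in> linear_maps K T T" and L: "L \<in> linear_maps K T T" and A: "A \<in> linear_maps K T T"
    and k: "k \<in> carrier K" and s: "s \<in> carrier K" and m: "m \<in> carrier K"
    and kms: "k \<oplus>\<^bsub>K\<^esub> m \<otimes>\<^bsub>K\<^esub> (s \<oplus>\<^bsub>K\<^esub> m) = \<zero>\<^bsub>K\<^esub>"
    and AR: "\<And>x. x \<in> carrier T \<Longrightarrow> A (R x) = R (A x)"
    and AL: "\<And>x. x \<in> carrier T \<Longrightarrow> A (L x) = L (A x)"
    and RR: "\<And>x. x \<in> carrier T \<Longrightarrow> R (R x) = s \<odot>\<^bsub>T\<^esub> A (R x)"
    and LL: "\<And>x. x \<in> carrier T \<Longrightarrow> L (L x) = s \<odot>\<^bsub>T\<^esub> A (L x)"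
    and braid: "\<And>x. x \<in> carrier T \<Longrightarrow> R (L (R x)) \<oplus>\<^bsub>T\<^esub> k \<odot>\<^bsub>T\<^esub> A (A (L x)) =
      L (R (L x)) \<oplus>\<^bsub>T\<^esub> k \<odot>\<^bsub>T\<^esub> A (A (R x))"
    and X: "\<And>x. x \<in> carrier T \<Longrightarrow> X x = R x \<oplus>\<^bsub>T\<^esub> m \<odot>\<^bsub>T\<^esub> A x"
    and Y: "\<And>x. x \<in> carrier T \<Longrightarrow> Y x = L x \<oplus>\<^bsub>T\<^esub> m \<odot>\<^bsub>T\<^esub> A x"
    and x: "x \<in> carrier T"
  shows "X (Y (X x)) = Y (X (Y x))"
proof -
  interpret T: module K T by fact
  note [simp] = linear_mapsD[OF R] linear_mapsD[OF L] linear_mapsD[OF A]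
  define j where "j = m \<otimes>\<^bsub>K\<^esub> (s \<oplus>\<^bsub>K\<^esub> m)"
  have j: "j \<in> carrier K" "k \<oplus>\<^bsub>K\<^esub> j = \<zero>\<^bsub>K\<^esub>" using k s m kms by (auto simp: j_def)
  define u where "u = R (A (A x))"
  define v where "v = L (A (A x))"
  have uv: "u \<in> carrier T" "v \<in> carrier T" using x by (simp_all add: u_def v_def)
  have cancel: "k \<odot>\<^bsub>T\<^esub> y \<oplus>\<^bsub>T\<^esub> j \<odot>\<^bsub>T\<^esub> y = \<zero>\<^bsub>T\<^esub>" if "y \<in> carrier T" for y
    using that k j by (simp add: T.smult_l_distr[symmetric])
  \<comment> \<open>\<open>Z\<close> collects the terms symmetric in \<open>R\<close> and \<open>L\<close>.\<close>
  define Z where "Z = m \<odot>\<^bsub>T\<^esub> R (L (A x)) \<oplus>\<^bsub>T\<^esub> m \<odot>\<^bsub>T\<^esub> L (R (A x)) \<oplus>\<^bsub>T\<^esub>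
    (m \<otimes>\<^bsub>K\<^esub> m) \<odot>\<^bsub>T\<^esub> u \<oplus>\<^bsub>T\<^esub> (m \<otimes>\<^bsub>K\<^esub> m) \<odot>\<^bsub>T\<^esub> v \<oplus>\<^bsub>T\<^esub> (m \<otimes>\<^bsub>K\<^esub> m \<otimes>\<^bsub>K\<^esub> m) \<odot>\<^bsub>T\<^esub> A (A (A x))"
  have Z: "Z \<in> carrier T" using x m uv by (simp add: Z_def)
  note exp = T.smult_r_distr T.smult_l_distr T.smult_assoc1[symmetric] T.R.m_ac T.M.a_ac AR AL RR LL
    T.R.r_distr
  have XYX: "X (Y (X x)) = (R (L (R x)) \<oplus>\<^bsub>T\<^esub> j \<odot>\<^bsub>T\<^esub> u) \<oplus>\<^bsub>T\<^esub> Z"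
    using x s m uv by (simp add: X Y Z_def j_def u_def v_def exp)
  have YXY: "Y (X (Y x)) = (L (R (L x)) \<oplus>\<^bsub>T\<^esub> j \<odot>\<^bsub>T\<^esub> v) \<oplus>\<^bsub>T\<^esub> Z"
    using x s m uv by (simp add: X Y Z_def j_def u_def v_def exp)
  have b: "R (L (R x)) \<oplus>\<^bsub>T\<^esub> k \<odot>\<^bsub>T\<^esub> v = L (R (L x)) \<oplus>\<^bsub>T\<^esub> k \<odot>\<^bsub>T\<^esub> u"
    using braid[OF x] x by (simp add: u_def v_def AR AL)
  have "R (L (R x)) \<oplus>\<^bsub>T\<^esub> j \<odot>\<^bsub>T\<^esub> u =
      (R (L (R x)) \<oplus>\<^bsub>T\<^esub> k \<odot>\<^bsub>T\<^esub> v) \<oplus>\<^bsub>T\<^esub> j \<odot>\<^bsub>T\<^esub> v \<oplus>\<^bsub>T\<^esub> j \<odot>\<^bsub>T\<^esub> u"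
    using cancel[OF uv(2)] x uv k j by (simp add: T.M.a_assoc)
  also have "\<dots> = L (R (L x)) \<oplus>\<^bsub>T\<^esub> j \<odot>\<^bsub>T\<^esub> v \<oplus>\<^bsub>T\<^esub> (k \<odot>\<^bsub>T\<^esub> u \<oplus>\<^bsub>T\<^esub> j \<odot>\<^bsub>T\<^esub> u)"
    unfolding b using x uv k j by (simp add: T.M.a_ac)
  also have "\<dots> = L (R (L x)) \<oplus>\<^bsub>T\<^esub> j \<odot>\<^bsub>T\<^esub> v"
    using cancel[OF uv(1)] x uv j by simp
  finally show ?thesis unfolding XYX YXY by simp
qed

section \<open>Structure maps on tensor powers of a Hom-coalgebra\<close>

context hom_coalgebra
begin

abbreviation T2 where "T2 \<equiv> tensor_module K C C"
abbreviation T3 where "T3 \<equiv> tensor_module K C T2"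
abbreviation T3' where "T3' \<equiv> tensor_module K T2 C"

abbreviation tensor2 (infixl "\<boxtimes>" 75) where "a \<boxtimes> b \<equiv> tensor K C C a b"
abbreviation tensor12 (infixl "\<boxtimes>\<^sub>r" 75) where "a \<boxtimes>\<^sub>r t \<equiv> tensor K C T2 a t"
abbreviation tensor21 (infixl "\<boxtimes>\<^sub>l" 75) where "t \<boxtimes>\<^sub>l c \<equiv> tensor K T2 C t c"

abbreviation J where "J \<equiv> tensor_assoc K C C C"

definition counitL where "counitL = tensor_lift K C C C (\<lambda>a b. \<epsilon> a \<odot>\<^bsub>C\<^esub> b)"
definition counitR where "counitR = tensor_lift K C C C (\<lambda>a b. \<epsilon> b \<odot>\<^bsub>C\<^esub> a)"

definition twist2 where "twist2 = tensor_map K C C C C \<alpha> \<alpha>"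
definition twist3 where "twist3 = tensor_map K C T2 C T2 \<alpha> twist2"

text \<open>The maps \<open>V = \<alpha> \<otimes> \<Delta>\<close> and \<open>W = \<Delta> \<otimes> \<alpha>\<close>, the latter reassociated so that both
  take values in \<open>C \<otimes> (C \<otimes> C)\<close>.\<close>

definition comult_right where "comult_right = tensor_map K C C C T2 \<alpha> \<Delta>"
definition comult_left where "comult_left t = J (tensor_map K C C T2 C \<Delta> \<alpha> t)"

lemma T2_module: "module K T2"
  by (rule module_tensor_module[OF vector_space_C vector_space_C])

lemma T3_module: "module K T3"
  by (rule module_tensor_module[OF vector_space_C T2_module])

lemma T3'_module: "module K T3'"
  by (rule module_tensor_module[OF T2_module vector_space_C])

sublocale C: module K C by (rule vector_space_C)
sublocale T2: module K T2 by (rule T2_module)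
sublocale T3: module K T3 by (rule T3_module)
sublocale T3': module K T3' by (rule T3'_module)

lemmas tensor_modules = vector_space_C T2_module T3_module T3'_module

lemma counit_simps [simp]:
  "x \<in> carrier C \<Longrightarrow> \<epsilon> x \<in> carrier K"
  "x \<in> carrier C \<Longrightarrow> y \<in> carrier C \<Longrightarrow> \<epsilon> (x \<oplus>\<^bsub>C\<^esub> y) = \<epsilon> x \<oplus>\<^bsub>K\<^esub> \<epsilon> y"
  "r \<in> carrier K \<Longrightarrow> x \<in> carrier C \<Longrightarrow> \<epsilon> (r \<odot>\<^bsub>C\<^esub> x) = r \<otimes>\<^bsub>K\<^esub> \<epsilon> x"
  using linear_mapsD[OF \<epsilon>_linear] by (auto simp: scalars_def)

declare \<epsilon>_\<alpha> [simp]

lemma eps_scaling_linear: "b \<in> carrier C \<Longrightarrow> (\<lambda>a. \<epsilon> a \<odot>\<^bsub>C\<^esub> b) \<in> linear_maps K C C"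
  by (rule linear_mapsI) (auto simp: C.smult_l_distr C.smult_assoc1)

lemma scaling_linear: "k \<in> carrier K \<Longrightarrow> (\<lambda>b. k \<odot>\<^bsub>C\<^esub> b) \<in> linear_maps K C C"
  by (rule linear_mapsI) (auto simp: C.smult_r_distr C.smult_assoc1[symmetric] C.R.m_comm)

lemma counitL_bilinear: "(\<lambda>a b. \<epsilon> a \<odot>\<^bsub>C\<^esub> b) \<in> bilinear_maps K C C C"
  and counitR_bilinear: "(\<lambda>a b. \<epsilon> b \<odot>\<^bsub>C\<^esub> a) \<in> bilinear_maps K C C C"
  by (auto simp: bilinear_maps_def intro!: eps_scaling_linear scaling_linear)

lemma counitL: "counitL \<in> linear_maps K T2 C"
    "a \<in> carrier C \<Longrightarrow> b \<in> carrier C \<Longrightarrow> counitL (a \<boxtimes> b) = \<epsilon> a \<odot>\<^bsub>C\<^esub> b"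
  and counitR: "counitR \<in> linear_maps K T2 C"
    "a \<in> carrier C \<Longrightarrow> b \<in> carrier C \<Longrightarrow> counitR (a \<boxtimes> b) = \<epsilon> b \<odot>\<^bsub>C\<^esub> a"
  unfolding counitL_def counitR_def
  using tensor_lift[OF tensor_modules(1,1,1) counitL_bilinear] tensor_lift[OF tensor_modules(1,1,1) counitR_bilinear]
  by auto

lemmas twist2 = tensor_map[OF tensor_modules(1,1,1,1) \<alpha>_linear \<alpha>_linear, folded twist2_def]
lemmas twist3 = tensor_map[OF tensor_modules(1,2,1,2) \<alpha>_linear twist2(1), folded twist3_def]
lemmas comult_right = tensor_map[OF tensor_modules(1,1,1,2) \<alpha>_linear \<Delta>_linear, folded comult_right_def]
lemmas assoc = tensor_assoc[OF tensor_modules(1,1,1)]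
lemmas assoc_inv = tensor_assoc_inv[OF tensor_modules(1,1,1)]
lemmas comult_tensor_twist = tensor_map[OF tensor_modules(1,1,2,1) \<Delta>_linear \<alpha>_linear]

lemma comult_left: "comult_left \<in> linear_maps K T2 T3"
    "a \<in> carrier C \<Longrightarrow> b \<in> carrier C \<Longrightarrow> comult_left (a \<boxtimes> b) = J (\<Delta> a \<boxtimes>\<^sub>l \<alpha> b)"
  unfolding comult_left_def using linear_maps_comp[OF comult_tensor_twist(1) assoc(1)] comult_tensor_twist(2) by auto

lemma act_right:
  assumes "B \<in> linear_maps K T2 T2"
  shows "act_right K C \<alpha> B \<in> linear_maps K T3 T3"
    and "\<And>a t. a \<in> carrier C \<Longrightarrow> t \<in> carrier T2 \<Longrightarrow> act_right K C \<alpha> B (a \<boxtimes>\<^sub>r t) = \<alpha> a \<boxtimes>\<^sub>r B t"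
  unfolding act_right_def using tensor_map[OF tensor_modules(1,2,1,2) \<alpha>_linear assms] by auto

lemma J_linear_left: "c \<in> carrier C \<Longrightarrow> (\<lambda>t. J (t \<boxtimes>\<^sub>l c)) \<in> linear_maps K T2 T3"
  by (rule linear_maps_comp[OF tensor_linear(2)[OF tensor_modules(2,1)] assoc(1)])

text \<open>The inverse associator in the definition of \<open>B \<otimes> \<alpha>\<close> cancels against \<open>J\<close>. With an arbitrary
  \<open>t\<close> in place of a pure tensor this also describes \<open>B \<otimes> \<alpha>\<close> on the image of \<open>\<Delta> \<otimes> \<alpha>\<close>.\<close>

lemma act_left:
  assumes B: "B \<in> linear_maps K T2 T2"
  shows "act_left K C B \<alpha> \<in> linear_maps K T3 T3"
    and "\<And>t c. t \<in> carrier T2 \<Longrightarrow> c \<in> carrier C \<Longrightarrow>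
      act_left K C B \<alpha> (J (t \<boxtimes>\<^sub>l c)) = J (B t \<boxtimes>\<^sub>l \<alpha> c)"
proof -
  note m = tensor_map[OF tensor_modules(2,1,2,1) B \<alpha>_linear]
  show lin: "act_left K C B \<alpha> \<in> linear_maps K T3 T3"
    unfolding act_left_def comp_def
    by (rule linear_maps_comp[OF linear_maps_comp[OF assoc_inv(1) m(1)] assoc(1)])
  show "act_left K C B \<alpha> (J (t \<boxtimes>\<^sub>l c)) = J (B t \<boxtimes>\<^sub>l \<alpha> c)"
    if t: "t \<in> carrier T2" and c: "c \<in> carrier C" for t c
  proof (rule tensor_ext[OF tensor_modules(1,1,3) _ _ _ t])
    show "(\<lambda>t. act_left K C B \<alpha> (J (t \<boxtimes>\<^sub>l c))) \<in> linear_maps K T2 T3"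
      by (rule linear_maps_comp[OF J_linear_left[OF c] lin])
    show "(\<lambda>t. J (B t \<boxtimes>\<^sub>l \<alpha> c)) \<in> linear_maps K T2 T3"
      by (rule linear_maps_comp[OF B J_linear_left[OF linear_mapsD(1)[OF \<alpha>_linear c]]])
    show "act_left K C B \<alpha> (J (a \<boxtimes> b \<boxtimes>\<^sub>l c)) = J (B (a \<boxtimes> b) \<boxtimes>\<^sub>l \<alpha> c)"
      if "a \<in> carrier C" "b \<in> carrier C" for a b
      using that c by (simp add: act_left_def assoc(2) assoc_inv(2) m(2) tensor_closed tensor_modules)
  qed
qed

lemmas linearity [simp] =
  linear_mapsD[OF \<alpha>_linear] linear_mapsD[OF \<Delta>_linear]
  linear_mapsD[OF counitL(1)] linear_mapsD[OF counitR(1)]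
  linear_mapsD[OF twist2(1)] linear_mapsD[OF twist3(1)]
  linear_mapsD[OF comult_left(1)] linear_mapsD[OF comult_right(1)]
  linear_mapsD[OF tensor_linear(1)[OF tensor_modules(1,1)]] linear_mapsD[OF tensor_linear(2)[OF tensor_modules(1,1)]]
  linear_mapsD[OF tensor_linear(1)[OF tensor_modules(1,2)]] linear_mapsD[OF tensor_linear(2)[OF tensor_modules(1,2)]]
  linear_mapsD[OF tensor_linear(1)[OF tensor_modules(2,1)]] linear_mapsD[OF tensor_linear(2)[OF tensor_modules(2,1)]]
  linear_mapsD[OF assoc(1)]

lemma counit_comult [simp]:
  "c \<in> carrier C \<Longrightarrow> counitL (\<Delta> c) = \<alpha> c" "c \<in> carrier C \<Longrightarrow> counitR (\<Delta> c) = \<alpha> c"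
  unfolding counitL_def counitR_def by (auto simp: counit_left counit_right)

lemma twist2_comult: "c \<in> carrier C \<Longrightarrow> twist2 (\<Delta> c) = \<Delta> (\<alpha> c)"
  by (simp add: \<Delta>_\<alpha> twist2_def)

lemma comult_coassoc: "c \<in> carrier C \<Longrightarrow> comult_left (\<Delta> c) = comult_right (\<Delta> c)"
  by (simp add: coassoc comult_left_def comult_right_def)

lemma linear_ext3:
  assumes f: "f \<in> linear_maps K T3 P" and g: "g \<in> linear_maps K T3 P" and P: "module K P"
    and eq: "\<And>a b c. a \<in> carrier C \<Longrightarrow> b \<in> carrier C \<Longrightarrow> c \<in> carrier C \<Longrightarrow>
      f (a \<boxtimes>\<^sub>r (b \<boxtimes> c)) = g (a \<boxtimes>\<^sub>r (b \<boxtimes> c))"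
    and x: "x \<in> carrier T3"
  shows "f x = g x"
proof (rule tensor_ext[OF tensor_modules(1,2) P f g _ x])
  fix a t assume a: "a \<in> carrier C" and t: "t \<in> carrier T2"
  note ta = tensor_linear(1)[OF tensor_modules(1,2) a]
  show "f (a \<boxtimes>\<^sub>r t) = g (a \<boxtimes>\<^sub>r t)"
    by (rule tensor_ext[OF tensor_modules(1,1) P linear_maps_comp[OF ta f] linear_maps_comp[OF ta g] _ t])
      (simp add: eq a)
qed

lemma twist3_comult_right: "s \<in> carrier T2 \<Longrightarrow> twist3 (comult_right s) = comult_right (twist2 s)"
  by (rule tensor_ext[OF tensor_modules(1,1,3) linear_maps_comp linear_maps_comp])
    (rule twist2(1) twist3(1) comult_right(1) | simp add: twist2(2) twist3(2) comult_right(2) twist2_comult)+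

lemma twist3_J:
  assumes t: "t \<in> carrier T2" and c: "c \<in> carrier C"
  shows "twist3 (J (t \<boxtimes>\<^sub>l c)) = J (twist2 t \<boxtimes>\<^sub>l \<alpha> c)"
proof (rule tensor_ext[OF tensor_modules(1,1,3) _ _ _ t])
  show "(\<lambda>t. twist3 (J (t \<boxtimes>\<^sub>l c))) \<in> linear_maps K T2 T3"
    by (rule linear_maps_comp[OF J_linear_left[OF c] twist3(1)])
  show "(\<lambda>t. J (twist2 t \<boxtimes>\<^sub>l \<alpha> c)) \<in> linear_maps K T2 T3"
    by (rule linear_maps_comp[OF twist2(1) J_linear_left]) (simp add: c)
qed (simp add: assoc(2) twist3(2) twist2(2) c)

lemma twist3_comult_left: "s \<in> carrier T2 \<Longrightarrow> twist3 (comult_left s) = comult_left (twist2 s)"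
  by (rule tensor_ext[OF tensor_modules(1,1,3) linear_maps_comp linear_maps_comp])
    (rule twist2(1) twist3(1) comult_left(1) | simp add: twist2(2) twist3_J comult_left(2) twist2_comult)+

end

section \<open>The core of the Hom-Yang-Baxter map\<close>

locale weighted_hom_coalgebra = hom_coalgebra +
  fixes l \<nu>
  assumes l_closed [simp]: "l \<in> carrier K" and nu_closed [simp]: "\<nu> \<in> carrier K"
begin

definition contract where
  "contract t = l \<odot>\<^bsub>C\<^esub> counitL t \<oplus>\<^bsub>C\<^esub> \<nu> \<odot>\<^bsub>C\<^esub> counitR t"

definition core where "core t = \<Delta> (contract t)"
definition core_right where "core_right = act_right K C \<alpha> core"
definition core_left where "core_left = act_left K C core \<alpha>"

lemma contract_linear: "contract \<in> linear_maps K T2 C"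
  unfolding contract_def
  by (intro linear_maps_add linear_maps_smult counitL counitR vector_space_C) auto

lemma core_linear: "core \<in> linear_maps K T2 T2"
  unfolding core_def by (rule linear_maps_comp[OF contract_linear \<Delta>_linear])

lemmas core_right = act_right[OF core_linear, folded core_right_def]
lemmas core_left = act_left[OF core_linear, folded core_left_def]

lemmas core_linearity [simp] =
  linear_mapsD[OF contract_linear] linear_mapsD[OF core_linear]
  linear_mapsD[OF core_left(1)] linear_mapsD[OF core_right(1)]

lemma contract_pure: "a \<in> carrier C \<Longrightarrow> b \<in> carrier C \<Longrightarrow>
    contract (a \<boxtimes> b) = (l \<otimes>\<^bsub>K\<^esub> \<epsilon> a) \<odot>\<^bsub>C\<^esub> b \<oplus>\<^bsub>C\<^esub> (\<nu> \<otimes>\<^bsub>K\<^esub> \<epsilon> b) \<odot>\<^bsub>C\<^esub> a"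
  by (simp add: contract_def counitL counitR C.smult_assoc1)

lemma contract_comult: "c \<in> carrier C \<Longrightarrow> contract (\<Delta> c) = (l \<oplus>\<^bsub>K\<^esub> \<nu>) \<odot>\<^bsub>C\<^esub> \<alpha> c"
  by (simp add: contract_def C.smult_l_distr)

lemma contract_twist2: "t \<in> carrier T2 \<Longrightarrow> contract (twist2 t) = \<alpha> (contract t)"
  by (rule tensor_ext[OF tensor_modules(1,1,1) linear_maps_comp linear_maps_comp])
    (rule twist2 contract_linear \<alpha>_linear | simp add: twist2(2) contract_pure)+

lemma core_right_eq: "x \<in> carrier C \<Longrightarrow> t \<in> carrier T2 \<Longrightarrow> core_right (x \<boxtimes>\<^sub>r t) = comult_right (x \<boxtimes> contract t)"
  by (simp add: core_right(2) comult_right(2) core_def)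

lemma core_left_eq: "t \<in> carrier T2 \<Longrightarrow> x \<in> carrier C \<Longrightarrow> core_left (J (t \<boxtimes>\<^sub>l x)) = comult_left (contract t \<boxtimes> x)"
  by (simp add: core_left(2) comult_left(2) core_def)

text \<open>The case \<open>t = \<Delta>(c)\<close> is the one that matters: there \<open>f(x \<otimes> c\<^sub>1) \<otimes> c\<^sub>2\<close> becomes
  \<open>\<lambda> \<epsilon>(x) \<Delta>(c) + \<nu> x \<otimes> \<alpha>(c)\<close> by the counit axiom. For general \<open>t\<close> both sides are linear in \<open>t\<close>, and on
  \<open>t = b \<otimes> c\<close> the left side is \<open>\<Delta>(f(x \<otimes> b)) \<otimes> \<alpha>(c)\<close>.\<close>

lemma core_left_tensor:
  assumes x: "x \<in> carrier C" and t: "t \<in> carrier T2"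
  shows "core_left (x \<boxtimes>\<^sub>r t) = comult_left ((l \<otimes>\<^bsub>K\<^esub> \<epsilon> x) \<odot>\<^bsub>T2\<^esub> t \<oplus>\<^bsub>T2\<^esub> \<nu> \<odot>\<^bsub>T2\<^esub> (x \<boxtimes> counitL t))"
proof (rule tensor_ext[OF tensor_modules(1,1,3) _ _ _ t])
  show "(\<lambda>t. core_left (x \<boxtimes>\<^sub>r t)) \<in> linear_maps K T2 T3"
    by (rule linear_maps_comp[OF tensor_linear(1)[OF tensor_modules(1,2) x] core_left(1)])
  have "(\<lambda>t. t) \<in> linear_maps K T2 T2" by (rule linear_mapsI) simp_all
  then show "(\<lambda>t. comult_left ((l \<otimes>\<^bsub>K\<^esub> \<epsilon> x) \<odot>\<^bsub>T2\<^esub> t \<oplus>\<^bsub>T2\<^esub> \<nu> \<odot>\<^bsub>T2\<^esub> (x \<boxtimes> counitL t)))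
      \<in> linear_maps K T2 T3"
    using x by (intro linear_maps_comp[OF _ comult_left(1)] linear_maps_add linear_maps_smult
        linear_maps_comp[OF counitL(1)] tensor_linear tensor_modules) auto
  show "core_left (x \<boxtimes>\<^sub>r (b \<boxtimes> c)) = comult_left ((l \<otimes>\<^bsub>K\<^esub> \<epsilon> x) \<odot>\<^bsub>T2\<^esub> (b \<boxtimes> c)
      \<oplus>\<^bsub>T2\<^esub> \<nu> \<odot>\<^bsub>T2\<^esub> (x \<boxtimes> counitL (b \<boxtimes> c)))"
    if b: "b \<in> carrier C" and c: "c \<in> carrier C" for b c
    using x b c by (simp add: assoc(2)[symmetric] core_left_eq contract_pure counitL(2) T2.smult_assoc1)
qed

text \<open>The mirror image: \<open>t\<^sub>1 \<otimes> f(t\<^sub>2 \<otimes> x)\<close> is expanded by the definition of \<open>f\<close>, to be used at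
  \<open>t = \<Delta>(p)\<close>.\<close>

lemma core_right_assoc:
  assumes x: "x \<in> carrier C" and t: "t \<in> carrier T2"
  shows "core_right (J (t \<boxtimes>\<^sub>l x)) = comult_right (l \<odot>\<^bsub>T2\<^esub> (counitR t \<boxtimes> x) \<oplus>\<^bsub>T2\<^esub> (\<nu> \<otimes>\<^bsub>K\<^esub> \<epsilon> x) \<odot>\<^bsub>T2\<^esub> t)"
proof (rule tensor_ext[OF tensor_modules(1,1,3) _ _ _ t])
  show "(\<lambda>t. core_right (J (t \<boxtimes>\<^sub>l x))) \<in> linear_maps K T2 T3"
    by (rule linear_maps_comp[OF J_linear_left[OF x] core_right(1)])
  have "(\<lambda>t. t) \<in> linear_maps K T2 T2" by (rule linear_mapsI) simp_all
  then show "(\<lambda>t. comult_right (l \<odot>\<^bsub>T2\<^esub> (counitR t \<boxtimes> x) \<oplus>\<^bsub>T2\<^esub> (\<nu> \<otimes>\<^bsub>K\<^esub> \<epsilon> x) \<odot>\<^bsub>T2\<^esub> t))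
      \<in> linear_maps K T2 T3"
    using x by (intro linear_maps_comp[OF _ comult_right(1)] linear_maps_add linear_maps_smult
        linear_maps_comp[OF counitR(1)] tensor_linear tensor_modules) auto
  show "core_right (J ((a \<boxtimes> b) \<boxtimes>\<^sub>l x)) = comult_right (l \<odot>\<^bsub>T2\<^esub> (counitR (a \<boxtimes> b) \<boxtimes> x)
      \<oplus>\<^bsub>T2\<^esub> (\<nu> \<otimes>\<^bsub>K\<^esub> \<epsilon> x) \<odot>\<^bsub>T2\<^esub> (a \<boxtimes> b))"
    if a: "a \<in> carrier C" and b: "b \<in> carrier C" for a b
    using x a b by (simp add: assoc(2) core_right_eq contract_pure counitR(2) T2.smult_assoc1)
qed

lemma twist3_core_right: "x \<in> carrier T3 \<Longrightarrow> twist3 (core_right x) = core_right (twist3 x)"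
  by (rule tensor_ext[OF tensor_modules(1,2,3) linear_maps_comp linear_maps_comp])
    (rule core_right(1) twist3(1) | simp add: twist3(2) twist2(2) core_right_eq twist3_comult_right contract_twist2)+

lemma twist3_core_left: "x \<in> carrier T3 \<Longrightarrow> twist3 (core_left x) = core_left (twist3 x)"
  by (rule linear_ext3[OF linear_maps_comp[OF core_left(1) twist3(1)]
        linear_maps_comp[OF twist3(1) core_left(1)] tensor_modules(3)])
    (simp_all add: assoc(2)[symmetric] twist3_J twist2(2) core_left_eq twist3_comult_left
        contract_twist2[symmetric])

text \<open>On \<open>p \<otimes> q\<close> the left side is \<open>\<alpha>\<^sup>2(p) \<otimes> \<Delta>(f(\<Delta>(q)))\<close>, where \<open>f \<circ> \<Delta> = (\<lambda> + \<nu>) \<alpha>\<close> applies. As the image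
  of \<open>\<alpha> \<otimes> (\<Delta> \<circ> f)\<close> lies in that of \<open>\<alpha> \<otimes> \<Delta>\<close>, this yields the quadratic relation
  \<open>core_right_core_right\<close>.\<close>

lemma core_right_comult_right:
  "s \<in> carrier T2 \<Longrightarrow> core_right (comult_right s) = (l \<oplus>\<^bsub>K\<^esub> \<nu>) \<odot>\<^bsub>T3\<^esub> comult_right (twist2 s)"
  by (rule tensor_ext[OF tensor_modules(1,1,3) linear_maps_comp
        linear_maps_smult[OF tensor_modules(3) linear_maps_comp]])
    (rule twist2(1) core_right(1) comult_right(1)
      | simp add: twist2(2) comult_right(2) core_right_eq contract_comult)+

lemma core_left_comult_left:
  "s \<in> carrier T2 \<Longrightarrow> core_left (comult_left s) = (l \<oplus>\<^bsub>K\<^esub> \<nu>) \<odot>\<^bsub>T3\<^esub> comult_left (twist2 s)"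
  by (rule tensor_ext[OF tensor_modules(1,1,3) linear_maps_comp
        linear_maps_smult[OF tensor_modules(3) linear_maps_comp]])
    (rule twist2(1) core_left(1) comult_left(1)
      | simp add: twist2(2) comult_left(2) core_left_eq contract_comult)+

lemma core_right_core_right:
  "x \<in> carrier T3 \<Longrightarrow> core_right (core_right x) = (l \<oplus>\<^bsub>K\<^esub> \<nu>) \<odot>\<^bsub>T3\<^esub> twist3 (core_right x)"
  by (rule tensor_ext[OF tensor_modules(1,2,3) linear_maps_comp
        linear_maps_smult[OF tensor_modules(3) linear_maps_comp]])
    (rule twist3(1) core_right(1) | simp add: core_right_eq core_right_comult_right twist3_comult_right)+

lemma core_left_core_left:
  "x \<in> carrier T3 \<Longrightarrow> core_left (core_left x) = (l \<oplus>\<^bsub>K\<^esub> \<nu>) \<odot>\<^bsub>T3\<^esub> twist3 (core_left x)"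
  by (rule linear_ext3[OF linear_maps_comp
        linear_maps_smult[OF tensor_modules(3) linear_maps_comp] tensor_modules(3)])
    (rule twist3(1) core_left(1)
      | simp add: assoc(2)[symmetric] core_left_eq core_left_comult_left twist3_comult_left)+

lemma core_left_comult_right: "p \<in> carrier C \<Longrightarrow> q \<in> carrier C \<Longrightarrow>
   core_left (comult_right (p \<boxtimes> q)) = comult_left ((l \<otimes>\<^bsub>K\<^esub> \<epsilon> p) \<odot>\<^bsub>T2\<^esub> \<Delta> q \<oplus>\<^bsub>T2\<^esub> \<nu> \<odot>\<^bsub>T2\<^esub> (\<alpha> p \<boxtimes> \<alpha> q))"
  by (simp add: comult_right(2) core_left_tensor)

lemma core_right_comult_left: "p \<in> carrier C \<Longrightarrow> q \<in> carrier C \<Longrightarrow>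
   core_right (comult_left (p \<boxtimes> q)) = comult_right (l \<odot>\<^bsub>T2\<^esub> (\<alpha> p \<boxtimes> \<alpha> q) \<oplus>\<^bsub>T2\<^esub> (\<nu> \<otimes>\<^bsub>K\<^esub> \<epsilon> q) \<odot>\<^bsub>T2\<^esub> \<Delta> p)"
  by (simp add: comult_left(2) core_right_assoc)

section \<open>The reduced braid relation\<close>

text \<open>The inner two maps give \<open>W(\<lambda> \<epsilon>(a) \<Delta>(y) + \<nu> \<alpha>(a) \<otimes> \<alpha>(y))\<close>. By coassociativity the
  first summand is also \<open>V(\<Delta>(y))\<close>, on which the outer map is \<open>(\<lambda> + \<nu>) A\<close>; the second one
  yields the term with \<open>A\<^sup>2\<close> and the term with \<open>\<nu>\<^sup>2\<close>.\<close>

lemma core_right_left_right: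
  assumes a: "a \<in> carrier C" and t: "t \<in> carrier T2"
  defines "y \<equiv> contract t"
  shows "core_right (core_left (core_right (a \<boxtimes>\<^sub>r t))) =
    (l \<otimes>\<^bsub>K\<^esub> \<nu>) \<odot>\<^bsub>T3\<^esub> twist3 (twist3 (core_right (a \<boxtimes>\<^sub>r t))) \<oplus>\<^bsub>T3\<^esub>
    comult_right (\<Delta> (\<alpha> ((l \<otimes>\<^bsub>K\<^esub> (l \<oplus>\<^bsub>K\<^esub> \<nu>) \<otimes>\<^bsub>K\<^esub> \<epsilon> a) \<odot>\<^bsub>C\<^esub> y \<oplus>\<^bsub>C\<^esub> (\<nu> \<otimes>\<^bsub>K\<^esub> \<nu> \<otimes>\<^bsub>K\<^esub> \<epsilon> y) \<odot>\<^bsub>C\<^esub> a)))"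
proof -
  have y: "y \<in> carrier C" unfolding y_def using t by simp
  show ?thesis using a t y
    by (simp add: core_right_eq y_def[symmetric] core_left_comult_right core_right_comult_left
       core_right_comult_right comult_coassoc
       twist3_comult_right twist2(2) twist2_comult T3.smult_assoc1[symmetric] T3.smult_r_distr T3.a_ac C.R.m_ac)
qed

lemma core_left_right_left:
  assumes c: "c \<in> carrier C" and t: "t \<in> carrier T2"
  defines "z \<equiv> contract t"
  shows "core_left (core_right (core_left (J (t \<boxtimes>\<^sub>l c)))) =
    (l \<otimes>\<^bsub>K\<^esub> \<nu>) \<odot>\<^bsub>T3\<^esub> twist3 (twist3 (core_left (J (t \<boxtimes>\<^sub>l c)))) \<oplus>\<^bsub>T3\<^esub>
    comult_right (\<Delta> (\<alpha> ((l \<otimes>\<^bsub>K\<^esub> l \<otimes>\<^bsub>K\<^esub> \<epsilon> z) \<odot>\<^bsub>C\<^esub> c \<oplus>\<^bsub>C\<^esub> (\<nu> \<otimes>\<^bsub>K\<^esub> (l \<oplus>\<^bsub>K\<^esub> \<nu>) \<otimes>\<^bsub>K\<^esub> \<epsilon> c) \<odot>\<^bsub>C\<^esub> z)))"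
proof -
  have z: "z \<in> carrier C" unfolding z_def using t by simp
  show ?thesis using c t z
    by (simp add: core_left_eq z_def[symmetric] core_left_comult_right core_right_comult_left
       core_left_comult_left comult_coassoc[symmetric]
       twist3_comult_left twist2(2) twist2_comult T3.smult_assoc1[symmetric] T3.smult_r_distr T3.a_ac C.R.m_ac)
qed

text \<open>As \<open>\<epsilon>(f(a \<otimes> b)) = (\<lambda> + \<nu>) \<epsilon>(a) \<epsilon>(b)\<close>, both sides expand to
  \<open>(\<lambda> + \<nu>) (\<lambda>\<^sup>2 \<epsilon>(a) \<epsilon>(b) c + \<lambda> \<nu> \<epsilon>(a) \<epsilon>(c) b + \<nu>\<^sup>2 \<epsilon>(b) \<epsilon>(c) a)\<close>.\<close>

lemma residue_symmetric:
  assumes a: "a \<in> carrier C" and b: "b \<in> carrier C" and c: "c \<in> carrier C"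
  defines "y \<equiv> contract (b \<boxtimes> c)" and "z \<equiv> contract (a \<boxtimes> b)"
  shows "(l \<otimes>\<^bsub>K\<^esub> (l \<oplus>\<^bsub>K\<^esub> \<nu>) \<otimes>\<^bsub>K\<^esub> \<epsilon> a) \<odot>\<^bsub>C\<^esub> y \<oplus>\<^bsub>C\<^esub> (\<nu> \<otimes>\<^bsub>K\<^esub> \<nu> \<otimes>\<^bsub>K\<^esub> \<epsilon> y) \<odot>\<^bsub>C\<^esub> a =
   (l \<otimes>\<^bsub>K\<^esub> l \<otimes>\<^bsub>K\<^esub> \<epsilon> z) \<odot>\<^bsub>C\<^esub> c \<oplus>\<^bsub>C\<^esub> (\<nu> \<otimes>\<^bsub>K\<^esub> (l \<oplus>\<^bsub>K\<^esub> \<nu>) \<otimes>\<^bsub>K\<^esub> \<epsilon> c) \<odot>\<^bsub>C\<^esub> z"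
  unfolding y_def z_def using a b c
  by (simp add: contract_pure C.R.l_distr C.R.r_distr C.smult_l_distr C.smult_r_distr
      C.smult_assoc1[symmetric] C.R.m_ac C.M.a_ac)

text \<open>The residues left over from \<open>X' Y' X'\<close> and \<open>Y' X' Y'\<close> on \<open>a \<otimes> b \<otimes> c\<close> coincide, so both sides
  equal the residue plus \<open>\<lambda> \<nu> A\<^sup>2 (X' + Y')\<close>.\<close>

lemma core_braid:
  assumes x: "x \<in> carrier T3"
  shows "core_right (core_left (core_right x)) \<oplus>\<^bsub>T3\<^esub> (l \<otimes>\<^bsub>K\<^esub> \<nu>) \<odot>\<^bsub>T3\<^esub> twist3 (twist3 (core_left x)) =
    core_left (core_right (core_left x)) \<oplus>\<^bsub>T3\<^esub> (l \<otimes>\<^bsub>K\<^esub> \<nu>) \<odot>\<^bsub>T3\<^esub> twist3 (twist3 (core_right x))"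
proof (rule linear_ext3[OF _ _ tensor_modules(3) _ x])
  note c = linear_maps_comp
  note LTT = c[OF c[OF core_left(1) twist3(1)] twist3(1)]
  note RTT = c[OF c[OF core_right(1) twist3(1)] twist3(1)]
  have k: "l \<otimes>\<^bsub>K\<^esub> \<nu> \<in> carrier K" by simp
  show "(\<lambda>x. core_right (core_left (core_right x)) \<oplus>\<^bsub>T3\<^esub> (l \<otimes>\<^bsub>K\<^esub> \<nu>) \<odot>\<^bsub>T3\<^esub> twist3 (twist3 (core_left x)))
      \<in> linear_maps K T3 T3"
    by (rule linear_maps_add[OF tensor_modules(3) c[OF c[OF core_right(1) core_left(1)] core_right(1)]
          linear_maps_smult[OF tensor_modules(3) LTT k]])
  show "(\<lambda>x. core_left (core_right (core_left x)) \<oplus>\<^bsub>T3\<^esub> (l \<otimes>\<^bsub>K\<^esub> \<nu>) \<odot>\<^bsub>T3\<^esub> twist3 (twist3 (core_right x)))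
      \<in> linear_maps K T3 T3"
    by (rule linear_maps_add[OF tensor_modules(3) c[OF c[OF core_left(1) core_right(1)] core_left(1)]
          linear_maps_smult[OF tensor_modules(3) RTT k]])
  fix a b c assume abc [simp]: "a \<in> carrier C" "b \<in> carrier C" "c \<in> carrier C"
  let ?x = "a \<boxtimes>\<^sub>r (b \<boxtimes> c)"
  define w where "w = comult_right (\<Delta> (\<alpha> ((l \<otimes>\<^bsub>K\<^esub> (l \<oplus>\<^bsub>K\<^esub> \<nu>) \<otimes>\<^bsub>K\<^esub> \<epsilon> a) \<odot>\<^bsub>C\<^esub> contract (b \<boxtimes> c)
    \<oplus>\<^bsub>C\<^esub> (\<nu> \<otimes>\<^bsub>K\<^esub> \<nu> \<otimes>\<^bsub>K\<^esub> \<epsilon> (contract (b \<boxtimes> c))) \<odot>\<^bsub>C\<^esub> a)))"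
  have w: "w \<in> carrier T3" unfolding w_def by simp
  have R: "core_right (core_left (core_right ?x)) =
      (l \<otimes>\<^bsub>K\<^esub> \<nu>) \<odot>\<^bsub>T3\<^esub> twist3 (twist3 (core_right ?x)) \<oplus>\<^bsub>T3\<^esub> w"
    unfolding w_def by (rule core_right_left_right) simp_all
  have L: "core_left (core_right (core_left ?x)) =
      (l \<otimes>\<^bsub>K\<^esub> \<nu>) \<odot>\<^bsub>T3\<^esub> twist3 (twist3 (core_left ?x)) \<oplus>\<^bsub>T3\<^esub> w"
    unfolding w_def residue_symmetric[OF abc]
    using core_left_right_left[OF abc(3), of "a \<boxtimes> b"] by (simp add: assoc(2))
  show "core_right (core_left (core_right ?x)) \<oplus>\<^bsub>T3\<^esub> (l \<otimes>\<^bsub>K\<^esub> \<nu>) \<odot>\<^bsub>T3\<^esub> twist3 (twist3 (core_left ?x)) =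
    core_left (core_right (core_left ?x)) \<oplus>\<^bsub>T3\<^esub> (l \<otimes>\<^bsub>K\<^esub> \<nu>) \<odot>\<^bsub>T3\<^esub> twist3 (twist3 (core_right ?x))"
    unfolding R L using w by (simp del: T3.smult_l_distr add: T3.M.a_ac)
qed

section \<open>The Hom-Yang-Baxter equation\<close>

definition hybe_map where "hybe_map = tensor_lift K C C T2
   (\<lambda>a b. ((l \<otimes>\<^bsub>K\<^esub> \<epsilon> a) \<odot>\<^bsub>T2\<^esub> \<Delta> b \<oplus>\<^bsub>T2\<^esub> (\<nu> \<otimes>\<^bsub>K\<^esub> \<epsilon> b) \<odot>\<^bsub>T2\<^esub> \<Delta> a)
      \<ominus>\<^bsub>T2\<^esub> l \<odot>\<^bsub>T2\<^esub> (\<alpha> a \<boxtimes> \<alpha> b))"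

lemmas hybe_map = tensor_lift[OF tensor_modules(1,1,2) hybe_map_bilinear[OF l_closed nu_closed], folded hybe_map_def]

lemma hybe_map_eq: "t \<in> carrier T2 \<Longrightarrow> hybe_map t = core t \<oplus>\<^bsub>T2\<^esub> (\<ominus>\<^bsub>K\<^esub> l) \<odot>\<^bsub>T2\<^esub> twist2 t"
  by (rule tensor_ext[OF tensor_modules(1,1,2) hybe_map(1)
        linear_maps_add[OF tensor_modules(2) core_linear linear_maps_smult[OF tensor_modules(2) twist2(1)]]])
    (simp_all add: hybe_map(2) core_def contract_pure twist2(2) a_minus_def T2.smult_l_minus)

lemma act_right_hybe_map:
  "x \<in> carrier T3 \<Longrightarrow> act_right K C \<alpha> hybe_map x = core_right x \<oplus>\<^bsub>T3\<^esub> (\<ominus>\<^bsub>K\<^esub> l) \<odot>\<^bsub>T3\<^esub> twist3 x"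
  by (rule tensor_ext[OF tensor_modules(1,2,3) act_right(1)[OF hybe_map(1)]
        linear_maps_add[OF tensor_modules(3) core_right(1) linear_maps_smult[OF tensor_modules(3) twist3(1)]]])
    (simp_all add: act_right(2)[OF hybe_map(1)] hybe_map_eq core_right(2) twist3(2))

lemma act_left_hybe_map:
  "x \<in> carrier T3 \<Longrightarrow> act_left K C hybe_map \<alpha> x = core_left x \<oplus>\<^bsub>T3\<^esub> (\<ominus>\<^bsub>K\<^esub> l) \<odot>\<^bsub>T3\<^esub> twist3 x"
  by (rule linear_ext3[OF act_left(1)[OF hybe_map(1)]
        linear_maps_add[OF tensor_modules(3) core_left(1) linear_maps_smult[OF tensor_modules(3) twist3(1)]] tensor_modules(3)])
    (simp_all add: act_left(2)[OF hybe_map(1)] hybe_map_eq core_left(2) twist3_J assoc(2)[symmetric])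

lemma twist2_hybe_map: "t \<in> carrier T2 \<Longrightarrow> twist2 (hybe_map t) = hybe_map (twist2 t)"
  by (simp add: hybe_map_eq core_def contract_twist2 twist2_comult)

lemma hybe_map_solution: "hybe_solution K C \<alpha> hybe_map"
  unfolding hybe_solution_def comp_def twist2_def[symmetric]
proof (intro conjI ballI)
  show "hybe_map \<in> linear_maps K T2 T2" by (rule hybe_map(1))
  show "twist2 (hybe_map t) = hybe_map (twist2 t)" if "t \<in> carrier T2" for t
    by (rule twist2_hybe_map[OF that])
  show "act_right K C \<alpha> hybe_map (act_left K C hybe_map \<alpha> (act_right K C \<alpha> hybe_map x)) =
    act_left K C hybe_map \<alpha> (act_right K C \<alpha> hybe_map (act_left K C hybe_map \<alpha> x))"
    if x: "x \<in> carrier T3" for x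
  proof (rule braid_shift[OF tensor_modules(3) core_right(1) core_left(1) twist3(1) _ _ _ _
        twist3_core_right twist3_core_left core_right_core_right core_left_core_left core_braid
        act_right_hybe_map act_left_hybe_map x])
    \<comment> \<open>The shift \<open>m = - \<lambda>\<close> and \<open>s = \<lambda> + \<nu>\<close> give \<open>m (s + m) = - \<lambda> \<nu>\<close>.\<close>
    have "(l \<oplus>\<^bsub>K\<^esub> \<nu>) \<oplus>\<^bsub>K\<^esub> \<ominus>\<^bsub>K\<^esub> l = \<nu> \<oplus>\<^bsub>K\<^esub> (l \<oplus>\<^bsub>K\<^esub> \<ominus>\<^bsub>K\<^esub> l)"
      using l_closed nu_closed by (simp only: C.R.a_ac C.R.add.inv_closed C.R.a_closed)
    also have "\<dots> = \<nu>" by (simp add: C.R.r_neg)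
    finally show "l \<otimes>\<^bsub>K\<^esub> \<nu> \<oplus>\<^bsub>K\<^esub> \<ominus>\<^bsub>K\<^esub> l \<otimes>\<^bsub>K\<^esub> ((l \<oplus>\<^bsub>K\<^esub> \<nu>) \<oplus>\<^bsub>K\<^esub> \<ominus>\<^bsub>K\<^esub> l) = \<zero>\<^bsub>K\<^esub>"
      by (simp add: C.R.l_minus C.R.r_neg)
  qed simp_all
qed

end

theorem theorem3p1:
  fixes K :: "('k, 'm) ring_scheme"
    and C :: "('k, 'c, 'p) module_scheme"
    and \<Delta> :: "'c \<Rightarrow> ('k, 'c, 'c) tensor"
    and \<epsilon> :: "'c \<Rightarrow> 'k"
    and \<alpha> :: "'c \<Rightarrow> 'c"
    and l \<nu> :: 'k
  assumes "hom_coalgebra K C \<Delta> \<epsilon> \<alpha>"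
    and "l \<in> carrier K" and "\<nu> \<in> carrier K"
  shows "hybe_solution K C \<alpha>
    (tensor_lift K C C (tensor_module K C C)
       (\<lambda>a b. ((l \<otimes>\<^bsub>K\<^esub> \<epsilon> a) \<odot>\<^bsub>tensor_module K C C\<^esub> \<Delta> b
               \<oplus>\<^bsub>tensor_module K C C\<^esub> (\<nu> \<otimes>\<^bsub>K\<^esub> \<epsilon> b) \<odot>\<^bsub>tensor_module K C C\<^esub> \<Delta> a)
              \<ominus>\<^bsub>tensor_module K C C\<^esub> l \<odot>\<^bsub>tensor_module K C C\<^esub> tensor K C C (\<alpha> a) (\<alpha> b)))"
proof -
  interpret weighted_hom_coalgebra K C \<Delta> \<epsilon> \<alpha> l \<nu>
    using assms by (simp add: weighted_hom_coalgebra_def weighted_hom_coalgebra_axioms_def)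
  show ?thesis by (rule hybe_map_solution[unfolded hybe_map_def])
qed

end
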